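(* Let $G$ be a finite group of order $N=|G|$ with identity $e$, and let $\mathcal{H}_A,\mathcal{H}_B$ be finite-dimensional complex Hilbert spaces. Let $\{U(f):f\in G\}$ be a projective unitary representation of $G$ on $\mathcal{H}_A$ with factor system $\{\mu(f,g)\}$ and $U(e)=I_A$, let $\{W(f):f\in G\}$ be a collection of operators on $\mathcal{H}_B$, and let $\mathcal{U}=\sum_{f\in G}U(f)\otimes W(f)$. Then: (a) The following three statements are equivalent: (i) The operator $M=\sum_{f\in G}R(f)\otimes W(f)$ on $\mathcal{H}_b\otimes\mathcal{H}_B$ is unitary, where $\mathcal{H}_b$ has orthonormal basis $\{|g\rangle:g\in G\}$ and $R(f)=\sum_{g\in G}\mu(g,f)\,|g\rangle\langle gf|$. (ii) There is a collection $\{\mathcal{Q}^{(\lambda)}:\lambda=1,\dots,\kappa\}$ of unitary matrices, $\mathcal{Q}^{(\lambda)}$ being of size $d_\lambda d_B\times d_\lambda d_B$ with entries $\mathcal{Q}^{(\lambda)}_{jp;kq}$, such that for all $f\in G$ and all $p,q$ $$W_{pq}(f)=\sum_{\lambda=1}^{\kappa}\frac{d_\lambda}{N}\sum_{j,k=1}^{d_\lambda}\left[D^{(\lambda)}_{jk}(f)\right]^*\mathcal{Q}^{(\lambda)}_{jp;kq}.$$ (iii) The $W(f)$ satisfy $$\sum_{f\in G}\mu^*(f,g)\,W^\dagger(f)\,W(fg)=\delta(e,g)\,I_B\qquad\text{for all }g\in G,$$ where $\delta(e,g)$ is $1$ if $g=e$ and $0$ otherwise. (b) Each of the three statements in (a)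 implies that $\mathcal{U}$ is unitary. (c) If $\mathcal{U}$ is unitary and the $U(f)$ are linearly independent, then all three statements in (a) hold. (d) If $\mathcal{U}$ is unitary and the $U(f)$ are linearly dependent (so the $W(f)$ are not uniquely determined by $\mathcal{U}=\sum_{f\in G}U(f)\otimes W(f)$), there exists at least one choice of operators $\{W'(f)\}$ on $\mathcal{H}_B$ with $\mathcal{U}=\sum_{f\in G}U(f)\otimes W'(f)$ such that the statements in (a) hold for $W'(f)$ in place of $W(f)$.
   Context: A projective unitary representation of $G$ with factor system $\mu$ is a family of unitary operators $U(f)$, $f\in G$, with $U(f)U(g)=\mu(f,g)U(fg)$ for all $f,g\in G$, where the $\mu(f,g)$ are complex numbers of magnitude 1. $\{D^{(\lambda)}(f)\}$, $\lambda=1,\dots,\kappa$, is a fixed complete list of inequivalent irreducible projective unitary matrix representations of $G$ with the same factor system $\mu$; $D^{(\lambda)}(f)$ is a $d_\lambda\times d_\lambda$ unitary matrix with entries $D^{(\lambda)}_{jk}(f)$, and $\sum_\lambda d_\lambda^2=N$. $d_B=\dim\mathcal{H}_B$, and $W_{pq}(f)$, $1\le p,q\le d_B$, are the matrix elements of $W(f)$ in a fixed orthonormal basis of $\mathcal{H}_B$. The rows of $\mathcal{Q}^{(\lambda)}$ are indexed by pairs $(j,p)$ and its columns by pairs $(k,q)$, with $1\le j,k\le d_\lambda$ and $1\le p,q\le d_B$. *)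

theory Defs
  imports
    "Jordan_Normal_Form.VS_Connect"
    "Jordan_Normal_Form.Schur_Decomposition"
    "HOL-Algebra.Coset"
begin

text \<open>
  A finite-dimensional complex Hilbert space of dimension \<open>n\<close> is represented by \<open>\<complex>\<^sup>n\<close>, through a
  fixed orthonormal basis; its operators are the matrices in \<open>carrier_mat n n\<close>. Indices start at 0.
  A basis vector with a pair label \<open>(i, p)\<close>, where \<open>p < n\<close>, has the position \<open>i * n + p\<close>.
\<close>

definition unitary_mat :: "nat \<Rightarrow> complex mat \<Rightarrow> bool" where
  "unitary_mat n A \<longleftrightarrow>
     A \<in> carrier_mat n n \<and> mat_adjoint A * A = 1\<^sub>m n \<and> A * mat_adjoint A = 1\<^sub>m n"

definition tensor_mat :: "complex mat \<Rightarrow> complex mat \<Rightarrow> complex mat" where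
  "tensor_mat A B = mat (dim_row A * dim_row B) (dim_col A * dim_col B)
     (\<lambda>(i, j). A $$ (i div dim_row B, j div dim_col B) * B $$ (i mod dim_row B, j mod dim_col B))"

abbreviation msum :: "nat \<Rightarrow> ('i \<Rightarrow> complex mat) \<Rightarrow> 'i set \<Rightarrow> complex mat" where
  "msum n F S \<equiv> finsum (module_mat TYPE(complex) n n) F S"

definition proj_unitary_rep ::
  "('g, 'm) monoid_scheme \<Rightarrow> ('g \<Rightarrow> 'g \<Rightarrow> complex) \<Rightarrow> nat \<Rightarrow> ('g \<Rightarrow> complex mat) \<Rightarrow> bool" where
  "proj_unitary_rep G \<mu> n U \<longleftrightarrow>
     (\<forall>f\<in>carrier G. unitary_mat n (U f)) \<and>
     (\<forall>f\<in>carrier G. \<forall>g\<in>carrier G. cmod (\<mu> f g) = 1) \<and>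
     (\<forall>f\<in>carrier G. \<forall>g\<in>carrier G. U f * U g = \<mu> f g \<cdot>\<^sub>m U (f \<otimes>\<^bsub>G\<^esub> g))"

definition irreducible_rep ::
  "('g, 'm) monoid_scheme \<Rightarrow> nat \<Rightarrow> ('g \<Rightarrow> complex mat) \<Rightarrow> bool" where
  "irreducible_rep G n D \<longleftrightarrow> 0 < n \<and>
     (\<forall>V. VectorSpace.subspace class_ring V (module_vec TYPE(complex) n) \<longrightarrow>
          (\<forall>f\<in>carrier G. \<forall>v\<in>V. D f *\<^sub>v v \<in> V) \<longrightarrow>
          V = {0\<^sub>v n} \<or> V = carrier_vec n)"

text \<open>
  Equivalence is by an invertible intertwiner and allows no additional phase factors, so it
  preserves the factor system.
\<close>

definition equivalent_reps ::
  "('g, 'm) monoid_scheme \<Rightarrow> nat \<Rightarrow> ('g \<Rightarrow> complex mat) \<Rightarrow> nat \<Rightarrow> ('g \<Rightarrow> complex mat) \<Rightarrow> bool" where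
  "equivalent_reps G m D n E \<longleftrightarrow> m = n \<and>
     (\<exists>S \<in> carrier_mat n n. invertible_mat S \<and> (\<forall>f\<in>carrier G. S * D f = E f * S))"

definition complete_irrep_list ::
  "('g, 'm) monoid_scheme \<Rightarrow> ('g \<Rightarrow> 'g \<Rightarrow> complex) \<Rightarrow> nat \<Rightarrow> (nat \<Rightarrow> nat) \<Rightarrow>
     (nat \<Rightarrow> 'g \<Rightarrow> complex mat) \<Rightarrow> bool" where
  "complete_irrep_list G \<mu> \<kappa> d D \<longleftrightarrow>
     (\<forall>l<\<kappa>. proj_unitary_rep G \<mu> (d l) (D l) \<and> irreducible_rep G (d l) (D l)) \<and>
     (\<forall>l<\<kappa>. \<forall>m<\<kappa>. l \<noteq> m \<longrightarrow> \<not> equivalent_reps G (d l) (D l) (d m) (D m)) \<and>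
     (\<forall>n E. proj_unitary_rep G \<mu> n E \<and> irreducible_rep G n E \<longrightarrow>
        (\<exists>l<\<kappa>. equivalent_reps G (d l) (D l) n E))"

text \<open>Linear independence of the indexed family: equal members make it dependent.\<close>

definition lin_indep_ops ::
  "('g, 'm) monoid_scheme \<Rightarrow> nat \<Rightarrow> ('g \<Rightarrow> complex mat) \<Rightarrow> bool" where
  "lin_indep_ops G n U \<longleftrightarrow>
     (\<forall>c :: 'g \<Rightarrow> complex. msum n (\<lambda>f. c f \<cdot>\<^sub>m U f) (carrier G) = 0\<^sub>m n n \<longrightarrow>
        (\<forall>f\<in>carrier G. c f = 0))"

definition op_expansion ::
  "('g, 'm) monoid_scheme \<Rightarrow> nat \<Rightarrow> nat \<Rightarrow> ('g \<Rightarrow> complex mat) \<Rightarrow> ('g \<Rightarrow> complex mat) \<Rightarrow>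
     complex mat" where
  "op_expansion G m n U W = msum (m * n) (\<lambda>f. tensor_mat (U f) (W f)) (carrier G)"

text \<open>
  The basis vectors \<open>|g\<rangle>\<close> are positioned by an enumeration \<open>b\<close> of the group. The summand
  \<open>\<mu>(g,f) |g\<rangle>\<langle>gf|\<close> is the entry in row \<open>g\<close> and column \<open>gf\<close>.
\<close>

definition twisted_regular ::
  "('g, 'm) monoid_scheme \<Rightarrow> ('g \<Rightarrow> 'g \<Rightarrow> complex) \<Rightarrow> (nat \<Rightarrow> 'g) \<Rightarrow> 'g \<Rightarrow> complex mat" where
  "twisted_regular G \<mu> b f = mat (Coset.order G) (Coset.order G)
     (\<lambda>(i, j). if b j = b i \<otimes>\<^bsub>G\<^esub> f then \<mu> (b i) f else 0)"

definition regular_unitary ::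
  "('g, 'm) monoid_scheme \<Rightarrow> ('g \<Rightarrow> 'g \<Rightarrow> complex) \<Rightarrow> (nat \<Rightarrow> 'g) \<Rightarrow> nat \<Rightarrow>
     ('g \<Rightarrow> complex mat) \<Rightarrow> bool" where
  "regular_unitary G \<mu> b dB W \<longleftrightarrow>
     unitary_mat (Coset.order G * dB) (op_expansion G (Coset.order G) dB (twisted_regular G \<mu> b) W)"

definition unitary_coefficients ::
  "('g, 'm) monoid_scheme \<Rightarrow> nat \<Rightarrow> (nat \<Rightarrow> nat) \<Rightarrow> (nat \<Rightarrow> 'g \<Rightarrow> complex mat) \<Rightarrow> nat \<Rightarrow>
     ('g \<Rightarrow> complex mat) \<Rightarrow> bool" where
  "unitary_coefficients G \<kappa> d D dB W \<longleftrightarrow>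
     (\<exists>Q :: nat \<Rightarrow> complex mat.
        (\<forall>l<\<kappa>. unitary_mat (d l * dB) (Q l)) \<and>
        (\<forall>f\<in>carrier G. \<forall>p<dB. \<forall>q<dB.
           W f $$ (p, q) =
             (\<Sum>l<\<kappa>. of_nat (d l) / of_nat (Coset.order G) *
                (\<Sum>j<d l. \<Sum>k<d l. cnj (D l f $$ (j, k)) * Q l $$ (j * dB + p, k * dB + q)))))"

definition twisted_orthonormal ::
  "('g, 'm) monoid_scheme \<Rightarrow> ('g \<Rightarrow> 'g \<Rightarrow> complex) \<Rightarrow> nat \<Rightarrow> ('g \<Rightarrow> complex mat) \<Rightarrow> bool" where
  "twisted_orthonormal G \<mu> dB W \<longleftrightarrow>
     (\<forall>g\<in>carrier G.
        msum dB (\<lambda>f. cnj (\<mu> f g) \<cdot>\<^sub>m (mat_adjoint (W f) * W (f \<otimes>\<^bsub>G\<^esub> g))) (carrier G) =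
          (if g = \<one>\<^bsub>G\<^esub> then 1 else 0) \<cdot>\<^sub>m 1\<^sub>m dB)"

end

theory Submission
  imports Defs "Jordan_Normal_Form.Spectral_Radius"
begin

text \<open>
  Writing \<open>X(g) = \<Sum>\<^sub>f \<mu>\<^sup>*(f,g) W\<^sup>\<dagger>(f) W(fg)\<close>, every projective representation \<open>U\<close> satisfies
  \<open>\<U>\<^sup>\<dagger> \<U> = \<Sum>\<^sub>g U(g) \<otimes> X(g)\<close>. Hence \<open>\<U>\<close> is unitary iff the coefficients \<open>X(g) - \<delta>(e,g) I\<close> are linear
  relations among the \<open>U(g)\<close>, whereas (iii) says that they vanish. The two agree when the \<open>U(g)\<close> are
  independent, in particular for the twisted regular representation, which is (i). By Schur
  orthogonality, the matrix \<open>Q\<close> of (ii) for the irrep \<open>D\<close> must be \<open>\<Sum>\<^sub>f D(f) \<otimes> W(f)\<close>, so (ii) says that the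
  coefficients are relations among the \<open>D(f)\<close> for all irreps at once; the count \<open>\<Sum> d\<^sup>2 = N\<close> gives
  completeness of the matrix entries, and only zero coefficients satisfy all these relations.

  For (d), a relation among the \<open>U(g)\<close> is a relation for each irrep occurring in \<open>U\<close>, so those \<open>Q\<close> are
  unitary. The other \<open>Q\<close> do not affect \<open>\<U>\<close> and can be replaced by identity matrices.
\<close>

section \<open>Entrywise description of matrix sums, adjoints and tensor products\<close>

lemma msum_carrier_mat [simp]:
  assumes "\<And>x. x \<in> S \<Longrightarrow> F x \<in> carrier_mat n n"
  shows "msum n F S \<in> carrier_mat n n"
proof -
  interpret abelian_group "module_mat TYPE(complex) n n"
    by (rule abelian_group_mat)
  have "F \<in> S \<rightarrow> carrier (module_mat TYPE(complex) n n)"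
    using assms by (auto simp: module_mat_simps)
  from finsum_closed[OF this] show ?thesis
    by (simp add: module_mat_simps)
qed

lemma index_msum:
  assumes "finite S" and "\<And>x. x \<in> S \<Longrightarrow> F x \<in> carrier_mat n n" and "i < n" "j < n"
  shows "msum n F S $$ (i, j) = (\<Sum>x\<in>S. F x $$ (i, j))"
  using assms(1,2)
proof (induction S)
  case empty
  interpret abelian_group "module_mat TYPE(complex) n n"
    by (rule abelian_group_mat)
  show ?case using assms(3,4) by (simp add: module_mat_simps)
next
  case (insert x S)
  interpret abelian_group "module_mat TYPE(complex) n n"
    by (rule abelian_group_mat)
  have "msum n F (insert x S) = F x + msum n F S"
    using finsum_insert[of S x F] insert by (auto simp: module_mat_simps)
  moreover have "msum n F S \<in> carrier_mat n n" using insert by simp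
  ultimately have "msum n F (insert x S) $$ (i, j) = F x $$ (i, j) + msum n F S $$ (i, j)"
    using assms(3,4) by simp
  then show ?case using insert by simp
qed

lemma mat_adjoint_carrier [simp]: "A \<in> carrier_mat m n \<Longrightarrow> mat_adjoint A \<in> carrier_mat n m"
  by (auto simp: mat_adjoint_def)

lemma index_mat_adjoint [simp]:
  assumes "A \<in> carrier_mat m n" "i < n" "j < m"
  shows "mat_adjoint A $$ (i, j) = cnj (A $$ (j, i))"
  using assms by (simp add: mat_adjoint_def mat_of_rows_def)

lemma index_mult_mat_sum:
  assumes "A \<in> carrier_mat m n" "B \<in> carrier_mat n k" "i < m" "j < k"
  shows "(A * B) $$ (i, j) = (\<Sum>r<n. A $$ (i, r) * B $$ (r, j))"
  using assms by (simp add: scalar_prod_def atLeast0LessThan)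

text \<open>A one-sided inverse of a square matrix is two-sided. Unitarity of an expansion is thus
  decided by the product of its adjoint with it, and the product in the other order never has to be
  computed.\<close>

lemma unitary_mat_iff:
  "unitary_mat n A \<longleftrightarrow> A \<in> carrier_mat n n \<and> mat_adjoint A * A = 1\<^sub>m n"
  unfolding unitary_mat_def using mat_mult_left_right_inverse[of "mat_adjoint A" n A] by auto

text \<open>Splits a sum over positions of a tensor product into blocks, matching the pair labels
  \<open>a * m + p\<close>.\<close>

lemma sum_lessThan_mult:
  fixes h :: "nat \<Rightarrow> 'a::comm_monoid_add"
  shows "(\<Sum>i<n * m. h i) = (\<Sum>a<n. \<Sum>p<m. h (a * m + p))"
proof -
  have "(\<Sum>i\<in>{a * m..<a * m + m}. h i) = (\<Sum>p<m. h (a * m + p))" for a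
    using sum.shift_bounds_nat_ivl[of h 0 "a * m" m] by (simp add: add.commute atLeast0LessThan)
  then show ?thesis using sum.nat_group[of h m n] by simp
qed

lemma pair_index_less: "a < n \<Longrightarrow> p < m \<Longrightarrow> a * m + p < n * (m::nat)"
proof -
  assume "a < n" "p < m"
  then have "a * m + p < Suc a * m" by simp
  also have "\<dots> \<le> n * m" using \<open>a < n\<close> by (intro mult_right_mono) auto
  finally show ?thesis .
qed

lemma pair_index_ex:
  assumes "i < n * (m::nat)"
  obtains a p where "a < n" "p < m" "i = a * m + p"
proof
  show "i div m < n" using assms by (simp add: less_mult_imp_div_less)
  have "0 < m" using assms by (cases m) auto
  then show "i mod m < m" by simp
qed simp

lemma eq_mat_pair_indexI:
  assumes "A \<in> carrier_mat (n * m) (n * m)" "B \<in> carrier_mat (n * m) (n * m)"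
    and "\<And>a p c q. a < n \<Longrightarrow> p < m \<Longrightarrow> c < n \<Longrightarrow> q < m \<Longrightarrow>
      A $$ (a * m + p, c * m + q) = B $$ (a * m + p, c * m + q)"
  shows "A = B"
proof (rule eq_matI)
  show "A $$ (i, j) = B $$ (i, j)" if "i < dim_row B" "j < dim_col B" for i j
    using that assms by (auto elim!: pair_index_ex)
qed (use assms in auto)

lemma tensor_mat_carrier [simp]:
  "A \<in> carrier_mat n n \<Longrightarrow> B \<in> carrier_mat m m \<Longrightarrow> tensor_mat A B \<in> carrier_mat (n * m) (n * m)"
  by (simp add: tensor_mat_def)

lemma index_tensor_mat:
  assumes "A \<in> carrier_mat n n" "B \<in> carrier_mat m m" "a < n" "p < m" "c < n" "q < m"
  shows "tensor_mat A B $$ (a * m + p, c * m + q) = A $$ (a, c) * B $$ (p, q)"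
  using assms by (simp add: tensor_mat_def pair_index_less)

section \<open>Invariant subspaces, intertwiners and Schur's lemma\<close>

lemma subspace_module_vecI:
  fixes V :: "complex vec set"
  assumes "V \<subseteq> carrier_vec n" "0\<^sub>v n \<in> V"
    and "\<And>v w. v \<in> V \<Longrightarrow> w \<in> V \<Longrightarrow> v + w \<in> V" and "\<And>c v. v \<in> V \<Longrightarrow> c \<cdot>\<^sub>v v \<in> V"
  shows "VectorSpace.subspace class_ring V (module_vec TYPE(complex) n)"
  using assms unfolding VectorSpace.subspace_def submodule_def
  by (auto simp: module_vec_simps vec_vs vec_module)

lemma irreducible_repD:
  fixes V :: "complex vec set"
  assumes "irreducible_rep G n D" "V \<subseteq> carrier_vec n" "0\<^sub>v n \<in> V"
    and "\<And>v w. v \<in> V \<Longrightarrow> w \<in> V \<Longrightarrow> v + w \<in> V" and "\<And>c v. v \<in> V \<Longrightarrow> c \<cdot>\<^sub>v v \<in> V"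
    and "\<And>f v. f \<in> carrier G \<Longrightarrow> v \<in> V \<Longrightarrow> D f *\<^sub>v v \<in> V"
  shows "V = {0\<^sub>v n} \<or> V = carrier_vec n"
  using assms(1) subspace_module_vecI[OF assms(2-5)] assms(6)
  unfolding irreducible_rep_def by blast

lemma index_mult_unit_vec:
  fixes A :: "complex mat"
  assumes "A \<in> carrier_mat m n" "i < m" "j < n"
  shows "(A *\<^sub>v unit_vec n j) $ i = A $$ (i, j)"
  using assms by auto

lemma mat_eq_zero_iff_mult_vec:
  fixes A :: "complex mat"
  assumes "A \<in> carrier_mat m n"
  shows "A = 0\<^sub>m m n \<longleftrightarrow> (\<forall>v\<in>carrier_vec n. A *\<^sub>v v = 0\<^sub>v m)"
proof
  assume *: "\<forall>v\<in>carrier_vec n. A *\<^sub>v v = 0\<^sub>v m"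
  show "A = 0\<^sub>m m n"
  proof (rule eq_matI)
    fix i j assume ij: "i < dim_row (0\<^sub>m m n)" "j < dim_col (0\<^sub>m m n)"
    have "(A *\<^sub>v unit_vec n j) $ i = A $$ (i, j)"
      using index_mult_unit_vec[OF assms] ij by simp
    then show "A $$ (i, j) = 0\<^sub>m m n $$ (i, j)" using * ij by auto
  qed (use assms in auto)
qed (use assms in auto)

text \<open>\<open>T\<close> maps the space of \<open>D\<close> to the space of \<open>E\<close>.
  The dimensions of \<open>E f\<close> and \<open>D f\<close> are included so that products can be
  reassociated from this fact alone.\<close>

definition intertwines ::
  "('g, 'm) monoid_scheme \<Rightarrow> nat \<Rightarrow> ('g \<Rightarrow> complex mat) \<Rightarrow> nat \<Rightarrow> ('g \<Rightarrow> complex mat) \<Rightarrow>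
     complex mat \<Rightarrow> bool" where
  "intertwines G m E n D T \<longleftrightarrow> T \<in> carrier_mat m n \<and>
     (\<forall>f\<in>carrier G. E f \<in> carrier_mat m m \<and> D f \<in> carrier_mat n n \<and> E f * T = T * D f)"

text \<open>The kernel of \<open>T\<close> is invariant under \<open>D\<close>, and it is not the
  whole space because \<open>T\<close> is nonzero. Irreducibility of the source leaves only the zero
  vector.\<close>

lemma intertwiner_injective:
  assumes T: "intertwines G m E n D T" "T \<noteq> 0\<^sub>m m n" and D: "irreducible_rep G n D"
    and v: "v \<in> carrier_vec n" "T *\<^sub>v v = 0\<^sub>v m"
  shows "v = 0\<^sub>v n"
proof -
  let ?V = "{v \<in> carrier_vec n. T *\<^sub>v v = 0\<^sub>v m}"
  have Tc: "T \<in> carrier_mat m n" using T by (simp add: intertwines_def)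
  have "?V = {0\<^sub>v n} \<or> ?V = carrier_vec n"
  proof (rule irreducible_repD[OF D])
    fix f v assume f: "f \<in> carrier G" and v: "v \<in> ?V"
    have c: "E f \<in> carrier_mat m m" "D f \<in> carrier_mat n n" "E f * T = T * D f"
      using T f by (auto simp: intertwines_def)
    have "T *\<^sub>v (D f *\<^sub>v v) = E f *\<^sub>v (T *\<^sub>v v)"
      using assoc_mult_mat_vec[OF c(1) Tc, of v] assoc_mult_mat_vec[OF Tc c(2), of v] c(3) v by simp
    then show "D f *\<^sub>v v \<in> ?V" using c v by auto
  qed (use Tc in \<open>auto simp: mult_add_distrib_mat_vec mult_mat_vec\<close>)
  moreover have "?V \<noteq> carrier_vec n"
    using T(2) mat_eq_zero_iff_mult_vec[OF Tc] by auto
  ultimately show ?thesis using v by blast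
qed

text \<open>Dually, the image of \<open>T\<close> is invariant under \<open>E\<close> and nonzero,
  so irreducibility of the target makes it everything.\<close>

lemma intertwiner_surjective:
  assumes T: "intertwines G m E n D T" "T \<noteq> 0\<^sub>m m n" and E: "irreducible_rep G m E"
    and w: "w \<in> carrier_vec m"
  shows "\<exists>v\<in>carrier_vec n. T *\<^sub>v v = w"
proof -
  let ?V = "(\<lambda>v. T *\<^sub>v v) ` carrier_vec n"
  have Tc: "T \<in> carrier_mat m n" using T by (simp add: intertwines_def)
  have "?V = {0\<^sub>v m} \<or> ?V = carrier_vec m"
  proof (rule irreducible_repD[OF E])
    show "0\<^sub>v m \<in> ?V" by (rule image_eqI[of _ _ "0\<^sub>v n"]) (use Tc in auto)
  next
    fix v w assume "v \<in> ?V" "w \<in> ?V"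
    then obtain a b where "a \<in> carrier_vec n" "b \<in> carrier_vec n" "v = T *\<^sub>v a" "w = T *\<^sub>v b"
      by blast
    then show "v + w \<in> ?V"
      using Tc by (intro image_eqI[of _ _ "a + b"]) (auto simp: mult_add_distrib_mat_vec)
  next
    fix c v assume "v \<in> ?V"
    then obtain a where "a \<in> carrier_vec n" "v = T *\<^sub>v a" by blast
    then show "c \<cdot>\<^sub>v v \<in> ?V"
      using Tc by (intro image_eqI[of _ _ "c \<cdot>\<^sub>v a"]) (auto simp: mult_mat_vec)
  next
    fix f v assume f: "f \<in> carrier G" and "v \<in> ?V"
    then obtain a where a: "a \<in> carrier_vec n" "v = T *\<^sub>v a" by blast
    have c: "E f \<in> carrier_mat m m" "D f \<in> carrier_mat n n" "E f * T = T * D f"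
      using T f by (auto simp: intertwines_def)
    have "E f *\<^sub>v v = T *\<^sub>v (D f *\<^sub>v a)"
      using assoc_mult_mat_vec[OF c(1) Tc a(1)] assoc_mult_mat_vec[OF Tc c(2) a(1)] c(3) a(2) by simp
    then show "E f *\<^sub>v v \<in> ?V"
      using c a by auto
  qed (use Tc in auto)
  moreover have "?V \<noteq> {0\<^sub>v m}"
    using T(2) mat_eq_zero_iff_mult_vec[OF Tc] by blast
  ultimately have "w \<in> ?V" using w by auto
  then show ?thesis by auto
qed

text \<open>Cyclicity of the trace, for rectangular factors. It serves to show that a matrix with a
  two-sided inverse is square.\<close>

lemma sum_diag_mult_commute:
  fixes A B :: "complex mat"
  assumes "A \<in> carrier_mat m n" "B \<in> carrier_mat n m"
  shows "(\<Sum>i<m. (A * B) $$ (i, i)) = (\<Sum>j<n. (B * A) $$ (j, j))"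
proof -
  have "(\<Sum>i<m. (A * B) $$ (i, i)) = (\<Sum>i<m. \<Sum>j<n. A $$ (i, j) * B $$ (j, i))"
    by (intro sum.cong) (auto simp: index_mult_mat_sum[OF assms] simp del: index_mult_mat)
  also have "\<dots> = (\<Sum>j<n. \<Sum>i<m. B $$ (j, i) * A $$ (i, j))"
    by (subst sum.swap) (simp add: mult.commute)
  also have "\<dots> = (\<Sum>j<n. (B * A) $$ (j, j))"
    by (intro sum.cong) (auto simp: index_mult_mat_sum[OF assms(2,1)] simp del: index_mult_mat)
  finally show ?thesis .
qed

text \<open>First half of Schur's lemma: a nonzero intertwiner of irreducibles is bijective.
  Surjectivity provides a right inverse, and injectivity makes it a left inverse as well.\<close>

lemma equivalent_reps_of_intertwiner:
  assumes T: "intertwines G m E n D T" "T \<noteq> 0\<^sub>m m n"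
    and D: "irreducible_rep G n D" and E: "irreducible_rep G m E"
  shows "equivalent_reps G n D m E"
proof -
  have Tc: "T \<in> carrier_mat m n" using T by (simp add: intertwines_def)
  \<comment> \<open>For \<open>i\<close> at or beyond \<open>m\<close>, \<open>unit_vec m i\<close>
    is the zero vector and still has a preimage, so the choice function can be total.\<close>
  have "\<forall>i. \<exists>v\<in>carrier_vec n. T *\<^sub>v v = unit_vec m i"
    using intertwiner_surjective[OF T E] by simp
  then obtain b where b: "\<And>i. b i \<in> carrier_vec n" "\<And>i. T *\<^sub>v b i = unit_vec m i"
    by metis
  \<comment> \<open>The columns of \<open>B\<close> are the chosen preimages of the standard basis
    vectors.\<close>
  define B where "B = mat n m (\<lambda>(i, j). b j $ i)"
  have Bc: "B \<in> carrier_mat n m" by (simp add: B_def)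
  have col_B: "col B j = b j" if "j < m" for j
    using that b(1)[of j] by (auto simp: B_def)
  have TB: "T * B = 1\<^sub>m m"
  proof (rule eq_matI)
    fix i j assume ij: "i < dim_row (1\<^sub>m m)" "j < dim_col (1\<^sub>m m)"
    then have "(T * B) $$ (i, j) = (T *\<^sub>v b j) $ i"
      using Tc Bc col_B by auto
    then show "(T * B) $$ (i, j) = 1\<^sub>m m $$ (i, j)" using ij b by simp
  qed (use Tc Bc in auto)
  have inj: "B *\<^sub>v (T *\<^sub>v v) = v" if v: "v \<in> carrier_vec n" for v
  proof -
    let ?w = "B *\<^sub>v (T *\<^sub>v v)"
    have w: "?w \<in> carrier_vec n"
      using mult_mat_vec_carrier[OF Bc mult_mat_vec_carrier[OF Tc v]] .
    have "T *\<^sub>v ?w = (T * B) *\<^sub>v (T *\<^sub>v v)"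
      using assoc_mult_mat_vec[OF Tc Bc, of "T *\<^sub>v v"] Tc v by simp
    also have "\<dots> = T *\<^sub>v v" using TB Tc v by simp
    finally have "T *\<^sub>v (?w - v) = 0\<^sub>v m"
      using Tc w v by (auto simp: mult_minus_distrib_mat_vec)
    then have "?w - v = 0\<^sub>v n"
      using intertwiner_injective[OF T D, of "?w - v"] w v by simp
    then have "?w $ i - v $ i = 0" if "i < n" for i
      using that w v index_minus_vec(1)[of i v ?w] by simp
    then show ?thesis using carrier_vecD[OF w] carrier_vecD[OF v] by (intro eq_vecI) (simp_all del: dim_mult_mat_vec)
  qed
  have BT: "B * T = 1\<^sub>m n"
  proof (rule eq_matI)
    fix i j assume ij: "i < dim_row (1\<^sub>m n)" "j < dim_col (1\<^sub>m n)"
    have "(B * T) *\<^sub>v unit_vec n j = unit_vec n j"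
      using inj[of "unit_vec n j"] Bc Tc by (simp add: assoc_mult_mat_vec[of B n m T n])
    moreover have "((B * T) *\<^sub>v unit_vec n j) $ i = (B * T) $$ (i, j)"
      using index_mult_unit_vec[OF mult_carrier_mat[OF Bc Tc]] ij by simp
    ultimately show "(B * T) $$ (i, j) = 1\<^sub>m n $$ (i, j)" using ij by simp
  qed (use Tc Bc in auto)
  \<comment> \<open>These are the traces of \<open>T * B\<close> and \<open>B * T\<close>, both
    identity matrices.\<close>
  have "complex_of_nat m = of_nat n"
    using sum_diag_mult_commute[OF Tc Bc] by (simp add: TB BT)
  then have mn: "m = n" by simp
  have "invertible_mat T"
    unfolding invertible_mat_def inverts_mat_def using Tc Bc TB BT mn
    by (auto simp: square_mat.simps intro!: exI[of _ B])
  then show ?thesis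
    unfolding equivalent_reps_def using T Tc mn by (auto simp: intertwines_def intro!: bexI[of _ T])
qed

text \<open>Second half of Schur's lemma. Over the complex numbers \<open>T\<close> has an
  eigenvalue \<open>k\<close>; then \<open>T\<close> minus \<open>k\<close> times the identity is an
  intertwiner with a nontrivial kernel, hence zero.\<close>

lemma self_intertwiner_scalar:
  assumes T: "intertwines G n D n D T" and D: "irreducible_rep G n D"
  shows "\<exists>k. T = k \<cdot>\<^sub>m 1\<^sub>m n"
proof -
  have Tc: "T \<in> carrier_mat n n" using T by (simp add: intertwines_def)
  have "0 < n" using D by (simp add: irreducible_rep_def)
  then obtain k where "eigenvalue T k"
    using spectrum_non_empty[OF Tc] by (auto simp: spectrum_def)
  then obtain v where v: "v \<in> carrier_vec n" "v \<noteq> 0\<^sub>v n" "T *\<^sub>v v = k \<cdot>\<^sub>v v"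
    using Tc by (auto simp: eigenvalue_def eigenvector_def)
  let ?S = "T - k \<cdot>\<^sub>m 1\<^sub>m n"
  have "D f * ?S = ?S * D f" if f: "f \<in> carrier G" for f
  proof -
    have c: "D f \<in> carrier_mat n n" "D f * T = T * D f"
      using T f by (auto simp: intertwines_def)
    then show ?thesis using Tc
      by (simp add: mult_minus_distrib_mat[of _ n n] minus_mult_distrib_mat[of _ n n]
          mult_smult_distrib[OF c(1) one_carrier_mat] mult_smult_assoc_mat[OF one_carrier_mat c(1)])
  qed
  then have S: "intertwines G n D n D ?S"
    using T by (auto simp: intertwines_def)
  have "(k \<cdot>\<^sub>m 1\<^sub>m n) *\<^sub>v v = k \<cdot>\<^sub>v v"
  proof (rule eq_vecI)
    fix i assume "i < dim_vec (k \<cdot>\<^sub>v v)"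
    then have i: "i < n" using v by simp
    have "row (k \<cdot>\<^sub>m 1\<^sub>m n) i = k \<cdot>\<^sub>v unit_vec n i" using i by auto
    then show "((k \<cdot>\<^sub>m 1\<^sub>m n) *\<^sub>v v) $ i = (k \<cdot>\<^sub>v v) $ i" using i v by auto
  qed (use v in auto)
  then have "?S *\<^sub>v v = 0\<^sub>v n"
    using Tc v by (auto simp: minus_mult_distrib_mat_vec[of _ n n])
  then have "?S = 0\<^sub>m n n"
    using intertwiner_injective[OF S _ D v(1)] v(2) by blast
  then have "T $$ (i, j) = (k \<cdot>\<^sub>m 1\<^sub>m n) $$ (i, j)" if "i < n" "j < n" for i j
  proof -
    have "?S $$ (i, j) = 0" using \<open>?S = 0\<^sub>m n n\<close> that by simp
    then show ?thesis using Tc that by auto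
  qed
  then show ?thesis using Tc by (intro exI[of _ k] eq_matI) auto
qed

section \<open>Factor systems and projective representations\<close>

text \<open>These are the laws of a normalized 2-cocycle of modulus 1. They are assumed here without
  reference to a representation, since the twisted regular representation is shown to be one by
  means of them; \<open>factor_system_of_rep\<close> obtains them from the given
  \<open>U\<close>.\<close>

locale factor_system = group G for G (structure) +
  fixes \<mu> :: "'a \<Rightarrow> 'a \<Rightarrow> complex"
  assumes finite_carrier: "finite (carrier G)"
    and norm_factor: "f \<in> carrier G \<Longrightarrow> g \<in> carrier G \<Longrightarrow> cmod (\<mu> f g) = 1"
    and cocycle: "f \<in> carrier G \<Longrightarrow> g \<in> carrier G \<Longrightarrow> h \<in> carrier G \<Longrightarrow>
      \<mu> f g * \<mu> (f \<otimes> g) h = \<mu> g h * \<mu> f (g \<otimes> h)"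
    and factor_one_left: "f \<in> carrier G \<Longrightarrow> \<mu> \<one> f = 1"
    and factor_one_right: "f \<in> carrier G \<Longrightarrow> \<mu> f \<one> = 1"
begin

abbreviation rep :: "nat \<Rightarrow> ('a \<Rightarrow> complex mat) \<Rightarrow> bool" where
  "rep \<equiv> proj_unitary_rep G \<mu>"

lemma cnj_factor_mult:
  assumes "f \<in> carrier G" "g \<in> carrier G"
  shows "cnj (\<mu> f g) * \<mu> f g = 1"
  using norm_factor[OF assms] by (simp add: complex_norm_square[symmetric] mult.commute)

lemma sum_translate:
  assumes "g \<in> carrier G"
  shows "(\<Sum>f\<in>carrier G. h (g \<otimes> f)) = (\<Sum>f\<in>carrier G. h f)"
  using assms
  by (intro sum.reindex_bij_witness[of _ "\<lambda>f. inv g \<otimes> f" "\<lambda>f. g \<otimes> f"]) (auto simp: m_assoc[symmetric])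

lemma order_pos: "0 < Coset.order G"
  using finite_carrier by (auto simp: Coset.order_def card_gt_0_iff)

lemma rep_carrier: "rep n E \<Longrightarrow> f \<in> carrier G \<Longrightarrow> E f \<in> carrier_mat n n"
  by (simp add: proj_unitary_rep_def unitary_mat_def)

lemma rep_mult:
  "rep n E \<Longrightarrow> f \<in> carrier G \<Longrightarrow> g \<in> carrier G \<Longrightarrow> E f * E g = \<mu> f g \<cdot>\<^sub>m E (f \<otimes> g)"
  by (simp add: proj_unitary_rep_def)

lemma rep_mult_entry:
  assumes "rep n E" "f \<in> carrier G" "g \<in> carrier G" "i < n" "j < n"
  shows "(\<Sum>r<n. E f $$ (i, r) * E g $$ (r, j)) = \<mu> f g * E (f \<otimes> g) $$ (i, j)"
proof -
  have c: "E f \<in> carrier_mat n n" "E g \<in> carrier_mat n n" "E (f \<otimes> g) \<in> carrier_mat n n"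
    using assms by (simp_all add: rep_carrier)
  have "(E f * E g) $$ (i, j) = (\<mu> f g \<cdot>\<^sub>m E (f \<otimes> g)) $$ (i, j)"
    using assms by (simp only: rep_mult)
  then show ?thesis using index_mult_mat_sum[OF c(1,2)] c assms by simp
qed

text \<open>Multiplying E(f) E(g) = \<mu>(f,g) E(fg) by the adjoint of E(f) cancels E(f), and the
  phase changes sides as its conjugate because it has modulus 1.\<close>

lemma rep_adjoint_mult:
  assumes E: "rep n E" and f: "f \<in> carrier G" and g: "g \<in> carrier G"
  shows "mat_adjoint (E f) * E (f \<otimes> g) = cnj (\<mu> f g) \<cdot>\<^sub>m E g"
proof -
  have c: "E f \<in> carrier_mat n n" "E g \<in> carrier_mat n n" "E (f \<otimes> g) \<in> carrier_mat n n"
    using assms by (simp_all add: rep_carrier)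
  have u: "mat_adjoint (E f) * E f = 1\<^sub>m n"
    using E f by (simp add: proj_unitary_rep_def unitary_mat_def)
  have "E g = (mat_adjoint (E f) * E f) * E g" using u c by simp
  also have "\<dots> = mat_adjoint (E f) * (E f * E g)"
    by (rule assoc_mult_mat[OF mat_adjoint_carrier[OF c(1)] c(1,2)])
  also have "\<dots> = \<mu> f g \<cdot>\<^sub>m (mat_adjoint (E f) * E (f \<otimes> g))"
    by (simp only: rep_mult[OF assms] mult_smult_distrib[OF mat_adjoint_carrier[OF c(1)] c(3)])
  finally have "cnj (\<mu> f g) \<cdot>\<^sub>m E g = (cnj (\<mu> f g) * \<mu> f g) \<cdot>\<^sub>m (mat_adjoint (E f) * E (f \<otimes> g))"
    by (auto intro!: eq_matI)
  moreover have "1 \<cdot>\<^sub>m A = A" for A :: "complex mat" by (rule eq_matI) auto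
  ultimately show ?thesis by (simp add: cnj_factor_mult f g)
qed

lemma rep_adjoint_mult_entry:
  assumes E: "rep n E" and f: "f \<in> carrier G" and g: "g \<in> carrier G" and ij: "i < n" "j < n"
  shows "(\<Sum>r<n. cnj (E f $$ (r, i)) * E (f \<otimes> g) $$ (r, j)) = cnj (\<mu> f g) * E g $$ (i, j)"
proof -
  have c: "E f \<in> carrier_mat n n" "E g \<in> carrier_mat n n" "E (f \<otimes> g) \<in> carrier_mat n n"
    using assms by (simp_all add: rep_carrier)
  have "(mat_adjoint (E f) * E (f \<otimes> g)) $$ (i, j) = (cnj (\<mu> f g) \<cdot>\<^sub>m E g) $$ (i, j)"
    using assms by (simp only: rep_adjoint_mult)
  then show ?thesis
    using index_mult_mat_sum[OF mat_adjoint_carrier[OF c(1)] c(3)] c ij by simp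
qed

text \<open>With \<mu>(e,e) = 1, taking both elements to be e in \<open>rep_adjoint_mult\<close>
  turns the unitarity of E(e) into E(e) = I. So the irreps are normalized in the same way as
  \<open>U\<close>.\<close>

lemma rep_one:
  assumes E: "rep n E"
  shows "E \<one> = 1\<^sub>m n"
proof -
  have c: "E \<one> \<in> carrier_mat n n" and u: "mat_adjoint (E \<one>) * E \<one> = 1\<^sub>m n"
    using E by (simp_all add: proj_unitary_rep_def unitary_mat_def)
  show ?thesis using rep_adjoint_mult[OF E one_closed one_closed] u c
    by (auto simp: factor_one_left intro!: eq_matI)
qed

lemma rep_orthonormal_columns:
  assumes E: "rep n E" and f: "f \<in> carrier G" and ij: "i < n" "j < n"
  shows "(\<Sum>r<n. cnj (E f $$ (r, i)) * E f $$ (r, j)) = (if i = j then 1 else 0)"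
  using rep_adjoint_mult_entry[OF E f one_closed ij] f ij
  by (simp add: rep_one[OF E] factor_one_right)

section \<open>Linear relations and operator expansions\<close>

text \<open>Says that \<open>c\<close> is a linear relation among the operators \<open>E f\<close>.
  The entrywise form suits the orthogonality relations, which concern single matrix entries.\<close>

definition annihilates :: "nat \<Rightarrow> ('a \<Rightarrow> complex mat) \<Rightarrow> ('a \<Rightarrow> complex) \<Rightarrow> bool" where
  "annihilates n E c \<longleftrightarrow> (\<forall>i<n. \<forall>j<n. (\<Sum>f\<in>carrier G. c f * E f $$ (i, j)) = 0)"

lemma lin_indep_ops_iff:
  assumes "\<And>f. f \<in> carrier G \<Longrightarrow> E f \<in> carrier_mat n n"
  shows "lin_indep_ops G n E \<longleftrightarrow> (\<forall>c. annihilates n E c \<longrightarrow> (\<forall>f\<in>carrier G. c f = 0))"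
proof -
  have "msum n (\<lambda>f. c f \<cdot>\<^sub>m E f) (carrier G) = 0\<^sub>m n n \<longleftrightarrow> annihilates n E c" for c
  proof -
    have c: "msum n (\<lambda>f. c f \<cdot>\<^sub>m E f) (carrier G) \<in> carrier_mat n n"
      using assms by simp
    have "msum n (\<lambda>f. c f \<cdot>\<^sub>m E f) (carrier G) $$ (i, j) = (\<Sum>f\<in>carrier G. c f * E f $$ (i, j))"
      if "i < n" "j < n" for i j
    proof -
      have "msum n (\<lambda>f. c f \<cdot>\<^sub>m E f) (carrier G) $$ (i, j) =
          (\<Sum>f\<in>carrier G. (c f \<cdot>\<^sub>m E f) $$ (i, j))"
        using assms that by (intro index_msum finite_carrier) auto
      also have "\<dots> = (\<Sum>f\<in>carrier G. c f * E f $$ (i, j))"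
        by (intro sum.cong refl index_smult_mat(1)) (use assms that in force)+
      finally show ?thesis .
    qed
    then show ?thesis using c unfolding annihilates_def
      by (auto simp: mat_eq_iff)
  qed
  then show ?thesis by (simp add: lin_indep_ops_def)
qed

lemma op_expansion_carrier [simp]:
  assumes "\<And>f. f \<in> carrier G \<Longrightarrow> E f \<in> carrier_mat n n"
    and "\<And>f. f \<in> carrier G \<Longrightarrow> X f \<in> carrier_mat m m"
  shows "op_expansion G n m E X \<in> carrier_mat (n * m) (n * m)"
  unfolding op_expansion_def by (rule msum_carrier_mat) (use assms in auto)

lemma index_op_expansion:
  assumes "\<And>f. f \<in> carrier G \<Longrightarrow> E f \<in> carrier_mat n n"
    and "\<And>f. f \<in> carrier G \<Longrightarrow> X f \<in> carrier_mat m m"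
    and "a < n" "p < m" "c < n" "q < m"
  shows "op_expansion G n m E X $$ (a * m + p, c * m + q) =
    (\<Sum>f\<in>carrier G. E f $$ (a, c) * X f $$ (p, q))"
proof -
  have "op_expansion G n m E X $$ (a * m + p, c * m + q) =
      (\<Sum>f\<in>carrier G. tensor_mat (E f) (X f) $$ (a * m + p, c * m + q))"
    unfolding op_expansion_def
    by (intro index_msum finite_carrier pair_index_less) (use assms in auto)
  also have "\<dots> = (\<Sum>f\<in>carrier G. E f $$ (a, c) * X f $$ (p, q))"
    using assms by (intro sum.cong refl index_tensor_mat) auto
  finally show ?thesis .
qed

text \<open>For fixed \<open>p\<close> and \<open>q\<close>, the entries of an expansion at all
  pairs \<open>(a, c)\<close> form the combination of the \<open>E f\<close> with scalar
  coefficients \<open>X f $$ (p, q)\<close>. Comparing tensor expansions thus reduces to scalar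
  relations.\<close>

lemma op_expansion_eq_iff:
  assumes E: "\<And>f. f \<in> carrier G \<Longrightarrow> E f \<in> carrier_mat n n"
    and X: "\<And>f. f \<in> carrier G \<Longrightarrow> X f \<in> carrier_mat m m"
    and Y: "\<And>f. f \<in> carrier G \<Longrightarrow> Y f \<in> carrier_mat m m"
  shows "op_expansion G n m E X = op_expansion G n m E Y \<longleftrightarrow>
    (\<forall>p<m. \<forall>q<m. annihilates n E (\<lambda>f. X f $$ (p, q) - Y f $$ (p, q)))" (is "?L \<longleftrightarrow> ?R")
proof -
  have *: "(\<Sum>f\<in>carrier G. (X f $$ (p, q) - Y f $$ (p, q)) * E f $$ (a, c)) =
    op_expansion G n m E X $$ (a * m + p, c * m + q) - op_expansion G n m E Y $$ (a * m + p, c * m + q)"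
    if "a < n" "p < m" "c < n" "q < m" for a p c q
    using that E X Y by (simp add: index_op_expansion) (simp add: sum_subtractf[symmetric] algebra_simps)
  show ?thesis
  proof
    assume ?R
    then show ?L
      by (intro eq_mat_pair_indexI[of _ n m] op_expansion_carrier E X Y) (auto simp: annihilates_def *)
  qed (auto simp: annihilates_def *)
qed

section \<open>Unitarity of an expansion and statement (iii)\<close>

text \<open>The coefficient X(g), which is the left-hand side of (iii).\<close>

definition correlation :: "nat \<Rightarrow> ('a \<Rightarrow> complex mat) \<Rightarrow> 'a \<Rightarrow> complex mat" where
  "correlation m W g =
     msum m (\<lambda>f. cnj (\<mu> f g) \<cdot>\<^sub>m (mat_adjoint (W f) * W (f \<otimes> g))) (carrier G)"

definition delta_mat :: "nat \<Rightarrow> 'a \<Rightarrow> complex mat" where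
  "delta_mat m g = (if g = \<one> then 1 else 0) \<cdot>\<^sub>m 1\<^sub>m m"

lemma delta_mat_carrier [simp]: "delta_mat m g \<in> carrier_mat m m"
  by (simp add: delta_mat_def)

lemma op_expansion_delta_mat:
  assumes E: "rep n E"
  shows "op_expansion G n m E (delta_mat m) = 1\<^sub>m (n * m)"
proof (rule eq_mat_pair_indexI)
  fix a p c q assume i: "a < n" "p < m" "c < n" "q < m"
  have "op_expansion G n m E (delta_mat m) $$ (a * m + p, c * m + q) =
      (\<Sum>f\<in>carrier G. if f = \<one> then E \<one> $$ (a, c) * (1\<^sub>m m $$ (p, q)) else 0)"
    using i E by (simp add: index_op_expansion rep_carrier) (auto intro!: sum.cong simp: delta_mat_def)
  also have "\<dots> = (if a = c \<and> p = q then 1 else 0)"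
    using i by (simp add: finite_carrier rep_one[OF E])
  also have "\<dots> = 1\<^sub>m (n * m) $$ (a * m + p, c * m + q)"
  proof -
    have "a = c \<and> p = q" if "a * m + p = c * m + q"
      using arg_cong[OF that, of "\<lambda>x. x div m"] arg_cong[OF that, of "\<lambda>x. x mod m"] i by simp
    then show ?thesis using i by (auto simp: pair_index_less)
  qed
  finally show "op_expansion G n m E (delta_mat m) $$ (a * m + p, c * m + q) =
      1\<^sub>m (n * m) $$ (a * m + p, c * m + q)" .
qed (use E in \<open>auto simp: rep_carrier\<close>)

lemma correlation_carrier [simp]:
  assumes "\<And>f. f \<in> carrier G \<Longrightarrow> W f \<in> carrier_mat m m" "g \<in> carrier G"
  shows "correlation m W g \<in> carrier_mat m m"
  unfolding correlation_def
  by (intro msum_carrier_mat smult_carrier_mat mult_carrier_mat[of _ m m] mat_adjoint_carrier)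
    (use assms in auto)

lemma index_correlation:
  assumes W: "\<And>f. f \<in> carrier G \<Longrightarrow> W f \<in> carrier_mat m m" and g: "g \<in> carrier G"
    and pq: "p < m" "q < m"
  shows "correlation m W g $$ (p, q) =
    (\<Sum>f\<in>carrier G. cnj (\<mu> f g) * (\<Sum>r<m. cnj (W f $$ (r, p)) * W (f \<otimes> g) $$ (r, q)))"
proof -
  have "correlation m W g $$ (p, q) =
      (\<Sum>f\<in>carrier G. (cnj (\<mu> f g) \<cdot>\<^sub>m (mat_adjoint (W f) * W (f \<otimes> g))) $$ (p, q))"
    unfolding correlation_def
    by (intro index_msum finite_carrier smult_carrier_mat mult_carrier_mat[of _ m m] mat_adjoint_carrier)
      (use assms in auto)
  also have "\<dots> = (\<Sum>f\<in>carrier G. cnj (\<mu> f g) * (\<Sum>r<m. cnj (W f $$ (r, p)) * W (f \<otimes> g) $$ (r, q)))"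
  proof (intro sum.cong refl)
    fix f assume f: "f \<in> carrier G"
    have c: "mat_adjoint (W f) \<in> carrier_mat m m" "W (f \<otimes> g) \<in> carrier_mat m m"
      using f g W by simp_all
    have "(mat_adjoint (W f) * W (f \<otimes> g)) $$ (p, q) =
        (\<Sum>r<m. cnj (W f $$ (r, p)) * W (f \<otimes> g) $$ (r, q))"
      using index_mult_mat_sum[OF c pq] W[OF f] pq by simp
    then show "(cnj (\<mu> f g) \<cdot>\<^sub>m (mat_adjoint (W f) * W (f \<otimes> g))) $$ (p, q) =
        cnj (\<mu> f g) * (\<Sum>r<m. cnj (W f $$ (r, p)) * W (f \<otimes> g) $$ (r, q))"
      using c pq by (simp del: index_mult_mat(1))
  qed
  finally show ?thesis .
qed

text \<open>The product is a double sum over f and h. With h = fg, the first tensor factor becomes a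
  phase times E(g), independent of f up to that phase, and the sum over f of the second factor is
  X(g).\<close>

lemma adjoint_mult_op_expansion:
  assumes E: "rep n E" and W: "\<And>f. f \<in> carrier G \<Longrightarrow> W f \<in> carrier_mat m m"
  shows "mat_adjoint (op_expansion G n m E W) * op_expansion G n m E W =
    op_expansion G n m E (correlation m W)"
proof (rule eq_mat_pair_indexI)
  let ?U = "op_expansion G n m E W"
  note Ec = rep_carrier[OF E]
  have Uc: "?U \<in> carrier_mat (n * m) (n * m)" using Ec W by simp
  show "mat_adjoint ?U * ?U \<in> carrier_mat (n * m) (n * m)"
    by (rule mult_carrier_mat[OF mat_adjoint_carrier[OF Uc] Uc])
  show "op_expansion G n m E (correlation m W) \<in> carrier_mat (n * m) (n * m)"
    using Ec W by simp
  fix a p c q assume i: "a < n" "p < m" "c < n" "q < m"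
  note pi = pair_index_less[OF i(1,2)] pair_index_less[OF i(3,4)]
  have "(mat_adjoint ?U * ?U) $$ (a * m + p, c * m + q) =
      (\<Sum>s<n * m. cnj (?U $$ (s, a * m + p)) * ?U $$ (s, c * m + q))"
    unfolding index_mult_mat_sum[OF mat_adjoint_carrier[OF Uc] Uc pi]
    using Uc pi by (intro sum.cong) auto
  also have "\<dots> = (\<Sum>b<n. \<Sum>r<m. cnj (\<Sum>f\<in>carrier G. E f $$ (b, a) * W f $$ (r, p)) *
      (\<Sum>h\<in>carrier G. E h $$ (b, c) * W h $$ (r, q)))"
    unfolding sum_lessThan_mult
    using i by (intro sum.cong refl) (simp add: index_op_expansion[OF Ec W])
  also have "\<dots> = (\<Sum>b<n. \<Sum>r<m. \<Sum>f\<in>carrier G. \<Sum>h\<in>carrier G.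
      (cnj (E f $$ (b, a)) * E h $$ (b, c)) * (cnj (W f $$ (r, p)) * W h $$ (r, q)))"
    by (simp only: cnj_sum sum_product) (simp add: mult_ac)
  \<comment> \<open>The group sums move outward so that the sums over \<open>b\<close> and
    \<open>r\<close> separate into the entries of two matrix products.\<close>
  also have "\<dots> = (\<Sum>b<n. \<Sum>f\<in>carrier G. \<Sum>h\<in>carrier G. \<Sum>r<m.
      (cnj (E f $$ (b, a)) * E h $$ (b, c)) * (cnj (W f $$ (r, p)) * W h $$ (r, q)))"
    by (rule sum.cong[OF refl], rule trans[OF sum.swap], intro sum.cong refl, rule sum.swap)
  also have "\<dots> = (\<Sum>f\<in>carrier G. \<Sum>h\<in>carrier G. \<Sum>b<n. \<Sum>r<m.
      (cnj (E f $$ (b, a)) * E h $$ (b, c)) * (cnj (W f $$ (r, p)) * W h $$ (r, q)))"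
    by (rule trans[OF sum.swap], intro sum.cong refl, rule sum.swap)
  also have "\<dots> = (\<Sum>f\<in>carrier G. \<Sum>h\<in>carrier G.
      (\<Sum>b<n. cnj (E f $$ (b, a)) * E h $$ (b, c)) * (\<Sum>r<m. cnj (W f $$ (r, p)) * W h $$ (r, q)))"
    by (simp add: sum_product)
  \<comment> \<open>Substitution h = fg for each fixed f.\<close>
  also have "\<dots> = (\<Sum>f\<in>carrier G. \<Sum>g\<in>carrier G.
      (\<Sum>b<n. cnj (E f $$ (b, a)) * E (f \<otimes> g) $$ (b, c)) *
      (\<Sum>r<m. cnj (W f $$ (r, p)) * W (f \<otimes> g) $$ (r, q)))"
    by (intro sum.cong refl sum_translate[symmetric])
  also have "\<dots> = (\<Sum>f\<in>carrier G. \<Sum>g\<in>carrier G. cnj (\<mu> f g) * E g $$ (a, c) *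
      (\<Sum>r<m. cnj (W f $$ (r, p)) * W (f \<otimes> g) $$ (r, q)))"
    using i by (intro sum.cong refl) (simp add: rep_adjoint_mult_entry[OF E])
  also have "\<dots> = (\<Sum>g\<in>carrier G. E g $$ (a, c) * correlation m W g $$ (p, q))"
    using i W by (subst sum.swap) (simp add: index_correlation sum_distrib_left mult_ac)
  also have "\<dots> = op_expansion G n m E (correlation m W) $$ (a * m + p, c * m + q)"
    using i W by (simp add: index_op_expansion[OF Ec])
  finally show "(mat_adjoint ?U * ?U) $$ (a * m + p, c * m + q) =
      op_expansion G n m E (correlation m W) $$ (a * m + p, c * m + q)" .
qed

text \<open>The identity is itself an expansion in the same \<open>E\<close>, with coefficients
  \<open>delta_mat\<close>. Unitarity therefore equates two expansions.\<close>

lemma unitary_op_expansion_iff: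
  assumes E: "rep n E" and W: "\<And>f. f \<in> carrier G \<Longrightarrow> W f \<in> carrier_mat m m"
  shows "unitary_mat (n * m) (op_expansion G n m E W) \<longleftrightarrow>
    (\<forall>p<m. \<forall>q<m. annihilates n E (\<lambda>g. correlation m W g $$ (p, q) - delta_mat m g $$ (p, q)))"
proof -
  have "unitary_mat (n * m) (op_expansion G n m E W) \<longleftrightarrow>
      op_expansion G n m E (correlation m W) = op_expansion G n m E (delta_mat m)"
    using W rep_carrier[OF E]
    by (simp add: unitary_mat_iff adjoint_mult_op_expansion[OF E W] op_expansion_delta_mat[OF E])
  also have "\<dots> \<longleftrightarrow> (\<forall>p<m. \<forall>q<m. annihilates n E (\<lambda>g. correlation m W g $$ (p, q) - delta_mat m g $$ (p, q)))"
    using W rep_carrier[OF E] by (intro op_expansion_eq_iff) auto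
  finally show ?thesis .
qed

lemma twisted_orthonormal_iff:
  assumes W: "\<And>f. f \<in> carrier G \<Longrightarrow> W f \<in> carrier_mat m m"
  shows "twisted_orthonormal G \<mu> m W \<longleftrightarrow>
    (\<forall>g\<in>carrier G. \<forall>p<m. \<forall>q<m. correlation m W g $$ (p, q) - delta_mat m g $$ (p, q) = 0)"
proof -
  have "twisted_orthonormal G \<mu> m W \<longleftrightarrow> (\<forall>g\<in>carrier G. correlation m W g = delta_mat m g)"
    by (simp add: twisted_orthonormal_def correlation_def delta_mat_def)
  also have "\<dots> \<longleftrightarrow> (\<forall>g\<in>carrier G. \<forall>p<m. \<forall>q<m. correlation m W g $$ (p, q) = delta_mat m g $$ (p, q))"
  proof (intro ball_cong refl)
    fix g assume "g \<in> carrier G"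
    then have "correlation m W g \<in> carrier_mat m m" using W by simp
    moreover have "delta_mat m g \<in> carrier_mat m m" by simp
    ultimately show "correlation m W g = delta_mat m g \<longleftrightarrow>
        (\<forall>p<m. \<forall>q<m. correlation m W g $$ (p, q) = delta_mat m g $$ (p, q))"
      by (auto simp: mat_eq_iff simp del: delta_mat_carrier)
  qed
  finally show ?thesis by simp
qed

text \<open>Zero coefficients are a relation for every representation. This gives (b), and also the
  passage from (iii) to (i) and to (ii).\<close>

lemma unitary_op_expansion_if_twisted_orthonormal:
  assumes "rep n E" and "\<And>f. f \<in> carrier G \<Longrightarrow> W f \<in> carrier_mat m m"
    and "twisted_orthonormal G \<mu> m W"
  shows "unitary_mat (n * m) (op_expansion G n m E W)"
  using assms by (simp add: twisted_orthonormal_iff unitary_op_expansion_iff annihilates_def)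

text \<open>Independence leaves only the zero relation. This gives (c), and the passage from (i) to
  (iii) when \<open>E\<close> is the twisted regular representation.\<close>

lemma twisted_orthonormal_if_unitary_op_expansion:
  assumes "rep n E" and "\<And>f. f \<in> carrier G \<Longrightarrow> W f \<in> carrier_mat m m"
    and "unitary_mat (n * m) (op_expansion G n m E W)" and "lin_indep_ops G n E"
  shows "twisted_orthonormal G \<mu> m W"
proof -
  have "\<forall>c. annihilates n E c \<longrightarrow> (\<forall>f\<in>carrier G. c f = 0)"
    using assms by (simp add: lin_indep_ops_iff rep_carrier)
  moreover have "\<forall>p<m. \<forall>q<m. annihilates n E (\<lambda>g. correlation m W g $$ (p, q) - delta_mat m g $$ (p, q))"
    using assms by (simp add: unitary_op_expansion_iff)
  ultimately have "\<forall>g\<in>carrier G. \<forall>p<m. \<forall>q<m. correlation m W g $$ (p, q) - delta_mat m g $$ (p, q) = 0"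
    by blast
  then show ?thesis using assms(2) by (simp add: twisted_orthonormal_iff)
qed

section \<open>The twisted regular representation and statement (i)\<close>

context
  fixes b :: "nat \<Rightarrow> 'a"
  assumes b: "bij_betw b {..<Coset.order G} (carrier G)"
begin

lemma enum_closed [simp]: "i < Coset.order G \<Longrightarrow> b i \<in> carrier G"
  using b by (auto simp: bij_betw_def)

lemma sum_enum: "(\<Sum>i<Coset.order G. h (b i)) = (\<Sum>f\<in>carrier G. h f)"
  by (rule sum.reindex_bij_betw[OF b])

lemma enum_eq_iff: "i < Coset.order G \<Longrightarrow> j < Coset.order G \<Longrightarrow> b i = b j \<longleftrightarrow> i = j"
  using b by (auto simp: bij_betw_def inj_on_def)

lemma twisted_regular_carrier [simp]:
  "twisted_regular G \<mu> b f \<in> carrier_mat (Coset.order G) (Coset.order G)"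
  by (simp add: twisted_regular_def)

lemma index_twisted_regular:
  "i < Coset.order G \<Longrightarrow> j < Coset.order G \<Longrightarrow>
    twisted_regular G \<mu> b f $$ (i, j) = (if b j = b i \<otimes> f then \<mu> (b i) f else 0)"
  by (simp add: twisted_regular_def)

lemma twisted_regular_rep: "rep (Coset.order G) (twisted_regular G \<mu> b)"
proof -
  let ?N = "Coset.order G" and ?R = "twisted_regular G \<mu> b"
  have "mat_adjoint (?R f) * ?R f = 1\<^sub>m ?N" if f: "f \<in> carrier G" for f
  proof (rule eq_matI)
    fix i j assume ij': "i < dim_row (1\<^sub>m ?N)" "j < dim_col (1\<^sub>m ?N)"
    then have ij: "i < ?N" "j < ?N" by simp_all
    have "(mat_adjoint (?R f) * ?R f) $$ (i, j) =
        (\<Sum>r<?N. (if b i = b r \<otimes> f then cnj (\<mu> (b r) f) else 0) * (if b j = b r \<otimes> f then \<mu> (b r) f else 0))"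
      unfolding index_mult_mat_sum[OF mat_adjoint_carrier[OF twisted_regular_carrier]
        twisted_regular_carrier ij]
    proof (intro sum.cong refl)
      fix r assume r: "r \<in> {..<?N}"
      then have "mat_adjoint (?R f) $$ (i, r) = cnj (?R f $$ (r, i))"
        using ij index_mat_adjoint[OF twisted_regular_carrier] by simp
      then show "mat_adjoint (?R f) $$ (i, r) * ?R f $$ (r, j) =
          (if b i = b r \<otimes> f then cnj (\<mu> (b r) f) else 0) * (if b j = b r \<otimes> f then \<mu> (b r) f else 0)"
        using r ij by (simp add: index_twisted_regular)
    qed
    also have "\<dots> = (\<Sum>g\<in>carrier G. (if b i = g \<otimes> f then cnj (\<mu> g f) else 0) * (if b j = g \<otimes> f then \<mu> g f else 0))"
      by (rule sum_enum[of "\<lambda>g. (if b i = g \<otimes> f then cnj (\<mu> g f) else 0) * (if b j = g \<otimes> f then \<mu> g f else 0)"])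
    \<comment> \<open>Column \<open>i\<close> has its only nonzero entry in the row of
      \<open>b i \<otimes> inv f\<close>; column \<open>j\<close> shares that row only if
      \<open>i = j\<close>, and the phases then cancel.\<close>
    also have "\<dots> = (\<Sum>g\<in>carrier G. if g = b i \<otimes> inv f then (if i = j then 1 else 0) else 0)"
    proof (intro sum.cong refl)
      fix g assume g: "g \<in> carrier G"
      have *: "b i = g \<otimes> f \<longleftrightarrow> g = b i \<otimes> inv f"
        using inv_solve_right[OF g enum_closed[OF ij(1)] f] by simp
      show "(if b i = g \<otimes> f then cnj (\<mu> g f) else 0) * (if b j = g \<otimes> f then \<mu> g f else 0) =
          (if g = b i \<otimes> inv f then (if i = j then 1 else 0) else 0)"
      proof (cases "b i = g \<otimes> f")
        case True
        then have "b j = g \<otimes> f \<longleftrightarrow> i = j"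
          using enum_eq_iff[OF ij(2,1)] by auto
        then show ?thesis using True * cnj_factor_mult[OF g f] by (cases "i = j") simp_all
      qed (use * in simp)
    qed
    also have "\<dots> = 1\<^sub>m ?N $$ (i, j)" using ij f by (simp add: finite_carrier)
    finally show "(mat_adjoint (?R f) * ?R f) $$ (i, j) = 1\<^sub>m ?N $$ (i, j)" .
  qed (auto simp: mat_adjoint_def twisted_regular_def)
  moreover have "?R f * ?R g = \<mu> f g \<cdot>\<^sub>m ?R (f \<otimes> g)" if f: "f \<in> carrier G" and g: "g \<in> carrier G" for f g
  proof (rule eq_matI)
    fix i j assume ij': "i < dim_row (\<mu> f g \<cdot>\<^sub>m ?R (f \<otimes> g))" "j < dim_col (\<mu> f g \<cdot>\<^sub>m ?R (f \<otimes> g))"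
    then have ij: "i < ?N" "j < ?N" by (simp_all add: twisted_regular_def)
    have "(?R f * ?R g) $$ (i, j) =
        (\<Sum>r<?N. (if b r = b i \<otimes> f then \<mu> (b i) f else 0) * (if b j = b r \<otimes> g then \<mu> (b r) g else 0))"
      unfolding index_mult_mat_sum[OF twisted_regular_carrier twisted_regular_carrier ij]
      using ij by (intro sum.cong refl) (simp add: index_twisted_regular)
    also have "\<dots> = (\<Sum>h\<in>carrier G. (if h = b i \<otimes> f then \<mu> (b i) f else 0) * (if b j = h \<otimes> g then \<mu> h g else 0))"
      by (rule sum_enum[of "\<lambda>h. (if h = b i \<otimes> f then \<mu> (b i) f else 0) * (if b j = h \<otimes> g then \<mu> h g else 0)"])
    also have "\<dots> = (\<Sum>h\<in>carrier G. if h = b i \<otimes> f then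
        \<mu> (b i) f * (if b j = b i \<otimes> f \<otimes> g then \<mu> (b i \<otimes> f) g else 0) else 0)"
      by (intro sum.cong refl) auto
    also have "\<dots> = \<mu> (b i) f * (if b j = b i \<otimes> f \<otimes> g then \<mu> (b i \<otimes> f) g else 0)"
      using ij f by (simp add: finite_carrier)
    \<comment> \<open>The cocycle law at \<open>b i\<close>, \<open>f\<close>, \<open>g\<close> is
      exactly the required comparison of phases.\<close>
    also have "\<dots> = \<mu> f g * (if b j = b i \<otimes> (f \<otimes> g) then \<mu> (b i) (f \<otimes> g) else 0)"
      using cocycle[OF enum_closed[OF ij(1)] f g] ij f g by (simp add: m_assoc)
    also have "\<dots> = (\<mu> f g \<cdot>\<^sub>m ?R (f \<otimes> g)) $$ (i, j)"
      using ij by (simp add: index_twisted_regular carrier_matD[OF twisted_regular_carrier])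
    finally show "(?R f * ?R g) $$ (i, j) = (\<mu> f g \<cdot>\<^sub>m ?R (f \<otimes> g)) $$ (i, j)" .
  qed (auto simp: twisted_regular_def)
  ultimately show ?thesis
    by (simp add: proj_unitary_rep_def unitary_mat_iff norm_factor)
qed

text \<open>The row of R(g) labelled by e is the basis row labelled by g, with phase \<mu>(e,g) = 1.
  The coefficient of f in a relation is therefore read off at the entry in row e and column
  f.\<close>

lemma twisted_regular_lin_indep: "lin_indep_ops G (Coset.order G) (twisted_regular G \<mu> b)"
  unfolding lin_indep_ops_iff[OF twisted_regular_carrier]
proof (intro allI impI ballI)
  fix c f assume c: "annihilates (Coset.order G) (twisted_regular G \<mu> b) c" and f: "f \<in> carrier G"
  have "\<exists>i<Coset.order G. b i = g" if "g \<in> carrier G" for g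
  proof -
    have "g \<in> b ` {..<Coset.order G}" using b that by (simp add: bij_betw_def)
    then show ?thesis by auto
  qed
  from this[OF one_closed] this[OF f] obtain i j
    where ij: "i < Coset.order G" "j < Coset.order G" "b i = \<one>" "b j = f"
    by auto
  have "(\<Sum>g\<in>carrier G. c g * twisted_regular G \<mu> b g $$ (i, j)) = (\<Sum>g\<in>carrier G. if g = f then c f else 0)"
    using ij f by (intro sum.cong refl) (auto simp: index_twisted_regular factor_one_left)
  then show "c f = 0" using c ij f by (simp add: annihilates_def finite_carrier)
qed

lemma regular_unitary_iff:
  assumes W: "\<And>f. f \<in> carrier G \<Longrightarrow> W f \<in> carrier_mat m m"
  shows "regular_unitary G \<mu> b m W \<longleftrightarrow> twisted_orthonormal G \<mu> m W"
  unfolding regular_unitary_def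
proof
  show "twisted_orthonormal G \<mu> m W"
    if "unitary_mat (Coset.order G * m) (op_expansion G (Coset.order G) m (twisted_regular G \<mu> b) W)"
    using twisted_regular_rep W that twisted_regular_lin_indep
    by (rule twisted_orthonormal_if_unitary_op_expansion)
  show "unitary_mat (Coset.order G * m) (op_expansion G (Coset.order G) m (twisted_regular G \<mu> b) W)"
    if "twisted_orthonormal G \<mu> m W"
    using twisted_regular_rep W that by (rule unitary_op_expansion_if_twisted_orthonormal)
qed

end

section \<open>Averaging over the group, and relations inherited by constituents\<close>

text \<open>The matrix is the sum over f of E(f) X D(f)', where the prime denotes the adjoint and X
  is the matrix unit at (b,k). Multiplication by E(g) gives \<mu>(g,f) E(gf) X D(f)', the phase is
  absorbed by \<mu>(g,f) D(f)' = D(gf)' D(g), and translation by g restores the sum.\<close>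

lemma intertwines_group_average:
  assumes E: "rep n E" and D: "rep m D" and b: "b < n" and k: "k < m"
  shows "intertwines G n E m D (mat n m (\<lambda>(a, j). \<Sum>f\<in>carrier G. E f $$ (a, b) * cnj (D f $$ (j, k))))"
    (is "intertwines G n E m D ?T")
  unfolding intertwines_def
proof (intro conjI ballI rep_carrier[OF E] rep_carrier[OF D])
  fix g assume g: "g \<in> carrier G"
  have Tc: "?T \<in> carrier_mat n m" by simp
  note Eg = rep_carrier[OF E g] and Dg = rep_carrier[OF D g]
  show "E g * ?T = ?T * D g"
  proof (rule eq_matI)
    fix a j assume "a < dim_row (?T * D g)" "j < dim_col (?T * D g)"
    then have i: "a < n" "j < m" using Dg by simp_all
    have "(E g * ?T) $$ (a, j) =
        (\<Sum>r<n. \<Sum>f\<in>carrier G. E g $$ (a, r) * E f $$ (r, b) * cnj (D f $$ (j, k)))"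
      unfolding index_mult_mat_sum[OF Eg Tc i] using i
      by (intro sum.cong refl) (simp add: sum_distrib_left mult.assoc)
    also have "\<dots> = (\<Sum>f\<in>carrier G. \<mu> g f * E (g \<otimes> f) $$ (a, b) * cnj (D f $$ (j, k)))"
      using i b by (subst sum.swap) (simp add: sum_distrib_right[symmetric] rep_mult_entry[OF E g])
    also have "\<dots> = (\<Sum>f\<in>carrier G. \<Sum>r<m. E (g \<otimes> f) $$ (a, b) * cnj (D (g \<otimes> f) $$ (r, k)) * D g $$ (r, j))"
    proof (intro sum.cong refl)
      fix f assume f: "f \<in> carrier G"
      have "\<mu> g f * cnj (D f $$ (j, k)) = cnj (\<Sum>r<m. cnj (D g $$ (r, j)) * D (g \<otimes> f) $$ (r, k))"
        using i k by (simp only: rep_adjoint_mult_entry[OF D g f]) simp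
      also have "\<dots> = (\<Sum>r<m. cnj (D (g \<otimes> f) $$ (r, k)) * D g $$ (r, j))"
        by (simp add: mult.commute)
      finally have "E (g \<otimes> f) $$ (a, b) * (\<mu> g f * cnj (D f $$ (j, k))) =
          E (g \<otimes> f) $$ (a, b) * (\<Sum>r<m. cnj (D (g \<otimes> f) $$ (r, k)) * D g $$ (r, j))" by simp
      then show "\<mu> g f * E (g \<otimes> f) $$ (a, b) * cnj (D f $$ (j, k)) =
          (\<Sum>r<m. E (g \<otimes> f) $$ (a, b) * cnj (D (g \<otimes> f) $$ (r, k)) * D g $$ (r, j))"
        by (simp add: sum_distrib_left mult_ac)
    qed
    also have "\<dots> = (\<Sum>f\<in>carrier G. \<Sum>r<m. E f $$ (a, b) * cnj (D f $$ (r, k)) * D g $$ (r, j))"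
      by (rule sum_translate[OF g, of "\<lambda>f. \<Sum>r<m. E f $$ (a, b) * cnj (D f $$ (r, k)) * D g $$ (r, j)"])
    also have "\<dots> = (?T * D g) $$ (a, j)"
      unfolding index_mult_mat_sum[OF Tc Dg i] using i
      by (subst sum.swap) (simp add: sum_distrib_right)
    finally show "(E g * ?T) $$ (a, j) = (?T * D g) $$ (a, j)" .
  qed (use Eg Dg in auto)
qed simp

text \<open>Multiplying the combination of the D(f) by \<open>T\<close> from the left gives the
  combination of the E(f) times \<open>T\<close>, which is zero. Irreducibility makes
  \<open>T\<close> injective, so it can be cancelled.\<close>

lemma annihilates_if_intertwines:
  assumes E: "rep n E" and T: "intertwines G n E m D T" "T \<noteq> 0\<^sub>m n m"
    and D: "irreducible_rep G m D" and c: "annihilates n E c"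
  shows "annihilates m D c"
proof -
  have Tc: "T \<in> carrier_mat n m" using T by (simp add: intertwines_def)
  have Dc: "D f \<in> carrier_mat m m" if "f \<in> carrier G" for f using T that by (simp add: intertwines_def)
  have "(\<Sum>f\<in>carrier G. c f * D f $$ (i, j)) = 0" if ij: "i < m" "j < m" for i j
  proof -
    \<comment> \<open>Column \<open>j\<close> of the combination of the \<open>D f\<close>.\<close>
    define v where "v = vec m (\<lambda>i. \<Sum>f\<in>carrier G. c f * D f $$ (i, j))"
    have v: "v \<in> carrier_vec m" by (simp add: v_def)
    have "T *\<^sub>v v = 0\<^sub>v n"
    proof (rule eq_vecI)
      fix a assume "a < dim_vec (0\<^sub>v n)"
      then have a: "a < n" by simp
      have "(T *\<^sub>v v) $ a = (\<Sum>r<m. T $$ (a, r) * (\<Sum>f\<in>carrier G. c f * D f $$ (r, j)))"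
        using Tc a by (auto simp: v_def scalar_prod_def atLeast0LessThan intro!: sum.cong)
      also have "\<dots> = (\<Sum>f\<in>carrier G. c f * (\<Sum>r<m. T $$ (a, r) * D f $$ (r, j)))"
        by (simp add: sum_distrib_left, subst sum.swap, simp add: mult_ac)
      also have "\<dots> = (\<Sum>f\<in>carrier G. c f * (\<Sum>r<n. E f $$ (a, r) * T $$ (r, j)))"
      proof (intro sum.cong refl)
        fix f assume f: "f \<in> carrier G"
        have "(T * D f) $$ (a, j) = (E f * T) $$ (a, j)" using T f by (simp add: intertwines_def)
        then show "c f * (\<Sum>r<m. T $$ (a, r) * D f $$ (r, j)) = c f * (\<Sum>r<n. E f $$ (a, r) * T $$ (r, j))"
          using index_mult_mat_sum[OF Tc Dc[OF f] a ij(2)]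
            index_mult_mat_sum[OF rep_carrier[OF E f] Tc a ij(2)] by simp
      qed
      also have "\<dots> = (\<Sum>r<n. (\<Sum>f\<in>carrier G. c f * E f $$ (a, r)) * T $$ (r, j))"
        by (simp add: sum_distrib_left sum_distrib_right, subst sum.swap, simp add: mult_ac)
      also have "\<dots> = 0" using c a by (simp add: annihilates_def)
      finally show "(T *\<^sub>v v) $ a = 0\<^sub>v n $ a" using a by simp
    qed (use Tc in auto)
    then have "v = 0\<^sub>v m" using intertwiner_injective[OF T D v] by blast
    then have "v $ i = 0" using ij by simp
    then show ?thesis using ij by (simp add: v_def)
  qed
  then show ?thesis by (simp add: annihilates_def)
qed

end

section \<open>Orthogonality, completeness and Fourier inversion for the irreps\<close>

text \<open>Enumerating both index sets turns the families into square matrices, where a right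
  inverse is a left inverse. This is the step from orthogonality to completeness.\<close>

lemma left_inverse_if_right_inverse:
  fixes A :: "'i \<Rightarrow> 'j \<Rightarrow> complex" and B :: "'j \<Rightarrow> 'i \<Rightarrow> complex"
  assumes fin: "finite I" "finite J" "card I = card J"
    and AB: "\<And>i i'. i \<in> I \<Longrightarrow> i' \<in> I \<Longrightarrow> (\<Sum>j\<in>J. A i j * B j i') = (if i = i' then 1 else 0)"
    and j: "j \<in> J" "j' \<in> J"
  shows "(\<Sum>i\<in>I. B j i * A i j') = (if j = j' then 1 else 0)"
proof -
  let ?N = "card I"
  obtain x y where x: "bij_betw x {..<?N} I" and y: "bij_betw y {..<?N} J"
    using ex_bij_betw_nat_finite[OF fin(1)] ex_bij_betw_nat_finite[OF fin(2)] fin(3)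
    by (auto simp: atLeast0LessThan)
  define A' where "A' = mat ?N ?N (\<lambda>(r, s). A (x r) (y s))"
  define B' where "B' = mat ?N ?N (\<lambda>(r, s). B (y r) (x s))"
  have c: "A' \<in> carrier_mat ?N ?N" "B' \<in> carrier_mat ?N ?N" by (simp_all add: A'_def B'_def)
  have xI: "x r \<in> I" if "r < ?N" for r using x that by (auto simp: bij_betw_def)
  have x_eq: "x r = x s \<longleftrightarrow> r = s" if "r < ?N" "s < ?N" for r s
    using x that by (auto simp: bij_betw_def inj_on_def)
  have y_eq: "y r = y s \<longleftrightarrow> r = s" if "r < ?N" "s < ?N" for r s
    using y that by (auto simp: bij_betw_def inj_on_def)
  have "A' * B' = 1\<^sub>m ?N"
  proof (rule eq_matI)
    fix r s assume "r < dim_row (1\<^sub>m ?N)" "s < dim_col (1\<^sub>m ?N)"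
    then have rs: "r < ?N" "s < ?N" by simp_all
    have "(A' * B') $$ (r, s) = (\<Sum>t<?N. A (x r) (y t) * B (y t) (x s))"
      unfolding index_mult_mat_sum[OF c rs] using rs
      by (intro sum.cong refl) (simp add: A'_def B'_def)
    also have "\<dots> = (\<Sum>j\<in>J. A (x r) j * B j (x s))"
      by (rule sum.reindex_bij_betw[OF y])
    also have "\<dots> = 1\<^sub>m ?N $$ (r, s)" using rs by (simp add: AB xI x_eq)
    finally show "(A' * B') $$ (r, s) = 1\<^sub>m ?N $$ (r, s)" .
  qed (use c in auto)
  then have BA: "B' * A' = 1\<^sub>m ?N" by (rule mat_mult_left_right_inverse[OF c])
  have "j \<in> y ` {..<?N}" "j' \<in> y ` {..<?N}" using y j by (simp_all add: bij_betw_def)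
  then obtain r s where rs: "r < ?N" "s < ?N" "j = y r" "j' = y s" by auto
  have "(\<Sum>i\<in>I. B j i * A i j') = (\<Sum>t<?N. B (y r) (x t) * A (x t) (y s))"
    unfolding rs(3,4) by (rule sum.reindex_bij_betw[OF x, symmetric])
  also have "\<dots> = (B' * A') $$ (r, s)"
    unfolding index_mult_mat_sum[OF c(2,1) rs(1,2)] using rs
    by (intro sum.cong refl) (simp add: A'_def B'_def)
  finally show ?thesis using rs by (simp add: BA y_eq)
qed

locale irrep_list = factor_system +
  fixes \<kappa> :: nat and d :: "nat \<Rightarrow> nat" and D :: "nat \<Rightarrow> 'a \<Rightarrow> complex mat"
  assumes complete: "complete_irrep_list G \<mu> \<kappa> d D"
    and sum_dims: "(\<Sum>l<\<kappa>. (d l)\<^sup>2) = Coset.order G"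
begin

lemma irrep_rep: "l < \<kappa> \<Longrightarrow> rep (d l) (D l)"
  and irrep_irreducible: "l < \<kappa> \<Longrightarrow> irreducible_rep G (d l) (D l)"
  and irrep_inequivalent: "l < \<kappa> \<Longrightarrow> m < \<kappa> \<Longrightarrow> l \<noteq> m \<Longrightarrow> \<not> equivalent_reps G (d l) (D l) (d m) (D m)"
  using complete by (simp_all add: complete_irrep_list_def)

lemma irrep_carrier: "l < \<kappa> \<Longrightarrow> f \<in> carrier G \<Longrightarrow> D l f \<in> carrier_mat (d l) (d l)"
  by (rule rep_carrier[OF irrep_rep])

text \<open>For fixed \<open>k\<close> and \<open>k'\<close> the sums are the entries of an averaged
  intertwiner. It vanishes between inequivalent irreps and is scalar on a single one, where the
  trace determines the scalar.\<close>

lemma schur_orthogonality: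
  assumes l: "l < \<kappa>" "l' < \<kappa>" and j: "j < d l" "j' < d l'" and k: "k < d l" "k' < d l'"
  shows "(\<Sum>f\<in>carrier G. D l f $$ (j, k) * cnj (D l' f $$ (j', k'))) =
    (if (l, j, k) = (l', j', k') then of_nat (Coset.order G) / of_nat (d l) else 0)"
proof -
  define T where "T = mat (d l) (d l') (\<lambda>(j, j'). \<Sum>f\<in>carrier G. D l f $$ (j, k) * cnj (D l' f $$ (j', k')))"
  have T: "intertwines G (d l) (D l) (d l') (D l') T"
    unfolding T_def using l k by (intro intertwines_group_average irrep_rep)
  have entry: "T $$ (i, i') = (\<Sum>f\<in>carrier G. D l f $$ (i, k) * cnj (D l' f $$ (i', k')))"
    if "i < d l" "i' < d l'" for i i'
    using that by (simp add: T_def)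
  show ?thesis
  proof (cases "l = l'")
    case False
    then have "T = 0\<^sub>m (d l) (d l')"
      using equivalent_reps_of_intertwiner[OF T] irrep_irreducible l irrep_inequivalent by metis
    then show ?thesis using entry[OF j] j False by simp
  next
    case True
    then obtain c where c: "T = c \<cdot>\<^sub>m 1\<^sub>m (d l)"
      using self_intertwiner_scalar[of G "d l" "D l" T] T irrep_irreducible l by auto
    have diag: "T $$ (i, i') = (if i = i' then c else 0)" if "i < d l" "i' < d l" for i i'
      using that by (simp add: c)
    \<comment> \<open>The trace of \<open>T\<close> sums inner products of columns \<open>k'\<close>
      and \<open>k\<close> of the unitary matrices \<open>D l f\<close>, one for each group
      element.\<close>
    have "of_nat (d l) * c = (\<Sum>i<d l. T $$ (i, i))" by (simp add: diag)
    also have "\<dots> = (\<Sum>i<d l. \<Sum>f\<in>carrier G. cnj (D l f $$ (i, k')) * D l f $$ (i, k))"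
      using True by (intro sum.cong refl) (simp add: entry mult.commute)
    also have "\<dots> = (\<Sum>f\<in>carrier G. if k' = k then 1 else 0)"
      using l k True by (subst sum.swap) (simp add: rep_orthonormal_columns[OF irrep_rep])
    also have "\<dots> = (if k = k' then of_nat (Coset.order G) else 0)"
      by (simp add: Coset.order_def)
    \<comment> \<open>\<open>j < d l\<close> makes the dimension positive, which permits the
      division.\<close>
    finally have "c = (if k = k' then of_nat (Coset.order G) / of_nat (d l) else 0)"
      using j(1) by (auto simp: field_simps)
    then show ?thesis using entry[OF j] diag[of j j'] j True by auto
  qed
qed

lemma sum_irrep_indices:
  "(\<Sum>(l, j, k)\<in>Sigma {..<\<kappa>} (\<lambda>l. {..<d l} \<times> {..<d l}). h l j k) = (\<Sum>l<\<kappa>. \<Sum>j<d l. \<Sum>k<d l. h l j k)"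
  by (simp add: sum.Sigma[symmetric] sum.cartesian_product[symmetric])

text \<open>Since the squared dimensions add up to N, the matrix with rows (l,j,k), columns f and
  entries \<open>D l f $$ (j, k)\<close> is square. Orthogonality provides its right inverse, with
  weights d/N; completeness says that this is also a left inverse.\<close>

lemma irrep_completeness:
  assumes "f \<in> carrier G" "g \<in> carrier G"
  shows "(\<Sum>l<\<kappa>. of_nat (d l) / of_nat (Coset.order G) *
      (\<Sum>j<d l. \<Sum>k<d l. cnj (D l f $$ (j, k)) * D l g $$ (j, k))) = (if f = g then 1 else 0)"
proof -
  let ?I = "Sigma {..<\<kappa>} (\<lambda>l. {..<d l} \<times> {..<d l})"
  let ?A = "\<lambda>(l, j, k) f. D l f $$ (j, k)"
  let ?B = "\<lambda>f (l, j, k). of_nat (d l) / of_nat (Coset.order G) * cnj (D l f $$ (j, k))"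
  have "(\<Sum>i\<in>?I. ?B f i * ?A i g) = (if f = g then 1 else 0)"
  proof (rule left_inverse_if_right_inverse[OF _ finite_carrier _ _ assms])
    show "card ?I = card (carrier G)"
      using sum_dims by (simp add: card_cartesian_product Coset.order_def power2_eq_square)
    fix i i' assume i: "i \<in> ?I" "i' \<in> ?I"
    obtain l j k l' j' k' where e: "i = (l, j, k)" "i' = (l', j', k')" by (metis prod_cases3)
    have "(\<Sum>f\<in>carrier G. ?A i f * ?B f i') = of_nat (d l') / of_nat (Coset.order G) *
        (\<Sum>f\<in>carrier G. D l f $$ (j, k) * cnj (D l' f $$ (j', k')))"
      by (simp add: e sum_distrib_left mult_ac)
    also have "\<dots> = (if i = i' then 1 else 0)"
      using i order_pos by (subst schur_orthogonality) (auto simp: e)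
    finally show "(\<Sum>f\<in>carrier G. ?A i f * ?B f i') = (if i = i' then 1 else 0)" .
  qed simp
  then show ?thesis
    using sum_irrep_indices[of "\<lambda>l j k. of_nat (d l) / of_nat (Coset.order G) *
      cnj (D l f $$ (j, k)) * D l g $$ (j, k)"]
    by (simp add: case_prod_beta' sum_distrib_left mult.assoc)
qed

lemma fourier_inversion:
  assumes f: "f \<in> carrier G"
  shows "c f = (\<Sum>l<\<kappa>. of_nat (d l) / of_nat (Coset.order G) *
    (\<Sum>j<d l. \<Sum>k<d l. cnj (D l f $$ (j, k)) * (\<Sum>g\<in>carrier G. c g * D l g $$ (j, k))))"
proof -
  have "c f = (\<Sum>g\<in>carrier G. if f = g then c g else 0)" using f by (simp add: finite_carrier)
  also have "\<dots> = (\<Sum>g\<in>carrier G. \<Sum>l<\<kappa>. \<Sum>j<d l. \<Sum>k<d l. of_nat (d l) / of_nat (Coset.order G) *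
      cnj (D l f $$ (j, k)) * (c g * D l g $$ (j, k)))"
  proof (intro sum.cong refl)
    fix g assume g: "g \<in> carrier G"
    have "(if f = g then c g else 0) = c g * (if f = g then 1 else 0)" by simp
    also have "\<dots> = (\<Sum>l<\<kappa>. \<Sum>j<d l. \<Sum>k<d l. of_nat (d l) / of_nat (Coset.order G) *
      cnj (D l f $$ (j, k)) * (c g * D l g $$ (j, k)))"
      unfolding irrep_completeness[OF f g, symmetric] by (simp add: sum_distrib_left mult_ac)
    finally show "(if f = g then c g else 0) = (\<Sum>l<\<kappa>. \<Sum>j<d l. \<Sum>k<d l.
      of_nat (d l) / of_nat (Coset.order G) * cnj (D l f $$ (j, k)) * (c g * D l g $$ (j, k)))" .
  qed
  also have "\<dots> = (\<Sum>l<\<kappa>. \<Sum>j<d l. \<Sum>k<d l. \<Sum>g\<in>carrier G. of_nat (d l) / of_nat (Coset.order G) *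
      cnj (D l f $$ (j, k)) * (c g * D l g $$ (j, k)))"
    by (rule trans[OF sum.swap], rule sum.cong[OF refl], rule trans[OF sum.swap],
        rule sum.cong[OF refl], rule sum.swap)
  also have "\<dots> = (\<Sum>l<\<kappa>. of_nat (d l) / of_nat (Coset.order G) *
    (\<Sum>j<d l. \<Sum>k<d l. cnj (D l f $$ (j, k)) * (\<Sum>g\<in>carrier G. c g * D l g $$ (j, k))))"
    by (simp add: sum_distrib_left mult.assoc)
  finally show ?thesis .
qed

text \<open>The entries of the combinations of the \<open>D l f\<close> are the Fourier coefficients
  of \<open>c\<close>; if all vanish, so does \<open>c\<close> on the group.\<close>

lemma zero_if_annihilates_irreps:
  assumes "\<And>l. l < \<kappa> \<Longrightarrow> annihilates (d l) (D l) c" and "f \<in> carrier G"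
  shows "c f = 0"
  by (subst fourier_inversion[OF assms(2)]) (use assms(1) in \<open>simp add: annihilates_def\<close>)

text \<open>A block of coefficients for an irrep \<open>D l\<close> that does not occur in \<open>E\<close> contributes nothing: its
  factor is an entry of an intertwiner from \<open>D l\<close> to \<open>E\<close>.\<close>

lemma annihilates_if_annihilates_constituents:
  assumes E: "rep n E"
    and c: "\<And>l T. l < \<kappa> \<Longrightarrow> intertwines G n E (d l) (D l) T \<Longrightarrow> T \<noteq> 0\<^sub>m n (d l) \<Longrightarrow> annihilates (d l) (D l) c"
  shows "annihilates n E c"
  unfolding annihilates_def
proof (intro allI impI)
  fix a b assume ab: "a < n" "b < n"
  let ?e = "\<lambda>l j k. \<Sum>f\<in>carrier G. E f $$ (a, b) * cnj (D l f $$ (j, k))"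
  let ?c = "\<lambda>l j k. \<Sum>g\<in>carrier G. c g * D l g $$ (j, k)"
  have zero: "?e l j k * ?c l j k = 0" if l: "l < \<kappa>" and jk: "j < d l" "k < d l" for l j k
  proof -
    let ?T = "mat n (d l) (\<lambda>(a, j). \<Sum>f\<in>carrier G. E f $$ (a, b) * cnj (D l f $$ (j, k)))"
    have T: "intertwines G n E (d l) (D l) ?T"
      using E irrep_rep[OF l] ab(2) jk(2) by (rule intertwines_group_average)
    show ?thesis
    proof (cases "?T = 0\<^sub>m n (d l)")
      case True
      then have "?T $$ (a, j) = 0" using ab jk by simp
      then show ?thesis using ab jk by simp
    next
      case False
      then show ?thesis using c[OF l T] jk by (simp add: annihilates_def)
    qed
  qed
  have "(\<Sum>f\<in>carrier G. c f * E f $$ (a, b)) = (\<Sum>f\<in>carrier G. \<Sum>l<\<kappa>. \<Sum>j<d l. \<Sum>k<d l.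
      of_nat (d l) / of_nat (Coset.order G) * (E f $$ (a, b) * cnj (D l f $$ (j, k)) * ?c l j k))"
  proof (intro sum.cong refl)
    fix f assume f: "f \<in> carrier G"
    show "c f * E f $$ (a, b) = (\<Sum>l<\<kappa>. \<Sum>j<d l. \<Sum>k<d l.
      of_nat (d l) / of_nat (Coset.order G) * (E f $$ (a, b) * cnj (D l f $$ (j, k)) * ?c l j k))"
      unfolding sum_distrib_left[symmetric] mult.assoc
      by (subst fourier_inversion[OF f, of c]) (simp add: sum_distrib_left mult_ac)
  qed
  also have "\<dots> = (\<Sum>l<\<kappa>. \<Sum>j<d l. \<Sum>k<d l. \<Sum>f\<in>carrier G.
      of_nat (d l) / of_nat (Coset.order G) * (E f $$ (a, b) * cnj (D l f $$ (j, k)) * ?c l j k))"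
    by (rule trans[OF sum.swap], rule sum.cong[OF refl], rule trans[OF sum.swap],
        rule sum.cong[OF refl], rule sum.swap)
  also have "\<dots> = (\<Sum>l<\<kappa>. \<Sum>j<d l. \<Sum>k<d l.
      of_nat (d l) / of_nat (Coset.order G) * (?e l j k * ?c l j k))"
    unfolding sum_distrib_left[symmetric] sum_distrib_right[symmetric] ..
  also have "\<dots> = 0" by (simp add: zero)
  finally show "(\<Sum>f\<in>carrier G. c f * E f $$ (a, b)) = 0" .
qed

section \<open>Fourier synthesis and statement (ii)\<close>

text \<open>The right-hand side of (ii): the inverse Fourier transform of the blocks
  \<open>Q l\<close>, taken separately for each \<open>p\<close> and \<open>q\<close>.\<close>

definition synthesis :: "(nat \<Rightarrow> complex mat) \<Rightarrow> nat \<Rightarrow> 'a \<Rightarrow> nat \<Rightarrow> nat \<Rightarrow> complex" where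
  "synthesis Q m f p q = (\<Sum>l<\<kappa>. of_nat (d l) / of_nat (Coset.order G) *
     (\<Sum>j<d l. \<Sum>k<d l. cnj (D l f $$ (j, k)) * Q l $$ (j * m + p, k * m + q)))"

text \<open>Orthogonality selects one block entry, and its N/d cancels the weight d/N. Hence
  \<open>Q\<close> in (ii) is determined by \<open>W\<close>.\<close>

lemma op_expansion_synthesis:
  assumes Q: "\<And>l. l < \<kappa> \<Longrightarrow> Q l \<in> carrier_mat (d l * m) (d l * m)"
    and W: "\<And>f. f \<in> carrier G \<Longrightarrow> W f \<in> carrier_mat m m"
    and WQ: "\<And>f p q. f \<in> carrier G \<Longrightarrow> p < m \<Longrightarrow> q < m \<Longrightarrow> W f $$ (p, q) = synthesis Q m f p q"
    and l: "l < \<kappa>"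
  shows "op_expansion G (d l) m (D l) W = Q l"
proof (rule eq_mat_pair_indexI)
  let ?I = "Sigma {..<\<kappa>} (\<lambda>l. {..<d l} \<times> {..<d l})"
  let ?N = "of_nat (Coset.order G) :: complex"
  fix a p c q assume i: "a < d l" "p < m" "c < d l" "q < m"
  have "op_expansion G (d l) m (D l) W $$ (a * m + p, c * m + q) =
      (\<Sum>f\<in>carrier G. D l f $$ (a, c) * synthesis Q m f p q)"
    using i l W by (simp add: index_op_expansion irrep_carrier WQ)
  also have "\<dots> = (\<Sum>f\<in>carrier G. \<Sum>(l', j, k)\<in>?I. of_nat (d l') / ?N * Q l' $$ (j * m + p, k * m + q) *
      (D l f $$ (a, c) * cnj (D l' f $$ (j, k))))"
    unfolding sum_irrep_indices by (simp add: synthesis_def sum_distrib_left mult_ac)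
  also have "\<dots> = (\<Sum>(l', j, k)\<in>?I. of_nat (d l') / ?N * Q l' $$ (j * m + p, k * m + q) *
      (\<Sum>f\<in>carrier G. D l f $$ (a, c) * cnj (D l' f $$ (j, k))))"
    by (subst sum.swap) (simp add: case_prod_beta' sum_distrib_left)
  also have "\<dots> = (\<Sum>x\<in>?I. if x = (l, a, c) then Q l $$ (a * m + p, c * m + q) else 0)"
  proof (intro sum.cong refl)
    fix x assume x: "x \<in> ?I"
    obtain l' j k where e: "x = (l', j, k)" by (metis prod_cases3)
    have "(\<Sum>f\<in>carrier G. D l f $$ (a, c) * cnj (D l' f $$ (j, k))) =
        (if (l, a, c) = (l', j, k) then ?N / of_nat (d l) else 0)"
      using x i l by (intro schur_orthogonality) (auto simp: e)
    then show "(case x of (l', j, k) \<Rightarrow> of_nat (d l') / ?N * Q l' $$ (j * m + p, k * m + q) *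
        (\<Sum>f\<in>carrier G. D l f $$ (a, c) * cnj (D l' f $$ (j, k)))) =
        (if x = (l, a, c) then Q l $$ (a * m + p, c * m + q) else 0)"
      using i order_pos by (auto simp: e)
  qed
  also have "\<dots> = Q l $$ (a * m + p, c * m + q)" using i l by simp
  finally show "op_expansion G (d l) m (D l) W $$ (a * m + p, c * m + q) = Q l $$ (a * m + p, c * m + q)" .
qed (use l Q W in \<open>auto simp: irrep_carrier\<close>)

lemma synthesis_op_expansion:
  assumes W: "\<And>f. f \<in> carrier G \<Longrightarrow> W f \<in> carrier_mat m m"
    and f: "f \<in> carrier G" and pq: "p < m" "q < m"
  shows "synthesis (\<lambda>l. op_expansion G (d l) m (D l) W) m f p q = W f $$ (p, q)"
proof -
  have "synthesis (\<lambda>l. op_expansion G (d l) m (D l) W) m f p q =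
      (\<Sum>l<\<kappa>. of_nat (d l) / of_nat (Coset.order G) *
        (\<Sum>j<d l. \<Sum>k<d l. cnj (D l f $$ (j, k)) * (\<Sum>g\<in>carrier G. W g $$ (p, q) * D l g $$ (j, k))))"
    unfolding synthesis_def using W pq
    by (intro sum.cong refl arg_cong2[of _ _ _ _ "(*)"])
      (simp add: index_op_expansion irrep_carrier mult.commute)
  also have "\<dots> = W f $$ (p, q)" by (rule fourier_inversion[OF f, symmetric])
  finally show ?thesis .
qed

text \<open>By the two preceding inversions, the only candidates for the blocks in (ii) are the
  expansions of \<open>W\<close> in the irreps, and these do reproduce \<open>W\<close>. Only their
  unitarity remains as a condition.\<close>

lemma unitary_coefficients_iff_op_expansion:
  assumes W: "\<And>f. f \<in> carrier G \<Longrightarrow> W f \<in> carrier_mat m m"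
  shows "unitary_coefficients G \<kappa> d D m W \<longleftrightarrow>
    (\<forall>l<\<kappa>. unitary_mat (d l * m) (op_expansion G (d l) m (D l) W))"
proof
  assume "unitary_coefficients G \<kappa> d D m W"
  then obtain Q where Q: "\<And>l. l < \<kappa> \<Longrightarrow> unitary_mat (d l * m) (Q l)"
    and WQ: "\<And>f p q. f \<in> carrier G \<Longrightarrow> p < m \<Longrightarrow> q < m \<Longrightarrow> W f $$ (p, q) = synthesis Q m f p q"
    unfolding unitary_coefficients_def synthesis_def by blast
  have "op_expansion G (d l) m (D l) W = Q l" if "l < \<kappa>" for l
    by (rule op_expansion_synthesis[OF _ W WQ that]) (use Q in \<open>auto simp: unitary_mat_def\<close>)
  then show "\<forall>l<\<kappa>. unitary_mat (d l * m) (op_expansion G (d l) m (D l) W)" using Q by simp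
next
  assume "\<forall>l<\<kappa>. unitary_mat (d l * m) (op_expansion G (d l) m (D l) W)"
  then show "unitary_coefficients G \<kappa> d D m W"
    unfolding unitary_coefficients_def
    using synthesis_op_expansion[OF W, symmetric, unfolded synthesis_def]
    by (intro exI[of _ "\<lambda>l. op_expansion G (d l) m (D l) W"]) auto
qed

lemma unitary_coefficients_iff:
  assumes W: "\<And>f. f \<in> carrier G \<Longrightarrow> W f \<in> carrier_mat m m"
  shows "unitary_coefficients G \<kappa> d D m W \<longleftrightarrow> twisted_orthonormal G \<mu> m W"
proof -
  have "unitary_coefficients G \<kappa> d D m W \<longleftrightarrow>
      (\<forall>l<\<kappa>. unitary_mat (d l * m) (op_expansion G (d l) m (D l) W))"
    using W by (rule unitary_coefficients_iff_op_expansion)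
  also have "\<dots> \<longleftrightarrow> twisted_orthonormal G \<mu> m W"
  proof
    assume "twisted_orthonormal G \<mu> m W"
    then show "\<forall>l<\<kappa>. unitary_mat (d l * m) (op_expansion G (d l) m (D l) W)"
      using W by (simp add: unitary_op_expansion_if_twisted_orthonormal irrep_rep)
  next
    assume u: "\<forall>l<\<kappa>. unitary_mat (d l * m) (op_expansion G (d l) m (D l) W)"
    have "correlation m W g $$ (p, q) - delta_mat m g $$ (p, q) = 0"
      if "g \<in> carrier G" "p < m" "q < m" for g p q
    proof (rule zero_if_annihilates_irreps[OF _ that(1),
          of "\<lambda>g. correlation m W g $$ (p, q) - delta_mat m g $$ (p, q)"])
      fix l assume "l < \<kappa>"
      then show "annihilates (d l) (D l) (\<lambda>g. correlation m W g $$ (p, q) - delta_mat m g $$ (p, q))"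
        using u W that by (simp add: unitary_op_expansion_iff irrep_rep)
    qed
    then show "twisted_orthonormal G \<mu> m W" using W by (simp add: twisted_orthonormal_iff)
  qed
  finally show ?thesis .
qed

text \<open>This is the construction for (d): the blocks of irreps occurring in \<open>E\<close> are
  kept and are already unitary, while the others are invisible in the expansion and are
  replaced.\<close>

lemma ex_equivalent_unitary_coefficients:
  assumes E: "rep n E" and W: "\<And>f. f \<in> carrier G \<Longrightarrow> W f \<in> carrier_mat m m"
    and u: "unitary_mat (n * m) (op_expansion G n m E W)"
  shows "\<exists>W'. (\<forall>f\<in>carrier G. W' f \<in> carrier_mat m m) \<and>
    op_expansion G n m E W = op_expansion G n m E W' \<and> unitary_coefficients G \<kappa> d D m W'"
proof -
  \<comment> \<open>A nonzero intertwiner embeds the irrep in \<open>E\<close>. This expresses being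
    a constituent without decomposing \<open>E\<close> into a direct sum.\<close>
  define occurs where "occurs l \<longleftrightarrow> (\<exists>T. intertwines G n E (d l) (D l) T \<and> T \<noteq> 0\<^sub>m n (d l))" for l
  define Q where "Q l = (if occurs l then op_expansion G (d l) m (D l) W else 1\<^sub>m (d l * m))" for l
  define W' where "W' f = mat m m (\<lambda>(p, q). synthesis Q m f p q)" for f
  have W': "W' f \<in> carrier_mat m m" for f by (simp add: W'_def)
  have Q: "unitary_mat (d l * m) (Q l)" if l: "l < \<kappa>" for l
  proof (cases "occurs l")
    case True
    then obtain T where T: "intertwines G n E (d l) (D l) T" "T \<noteq> 0\<^sub>m n (d l)"
      by (auto simp: occurs_def)
    have "\<forall>p<m. \<forall>q<m. annihilates n E (\<lambda>g. correlation m W g $$ (p, q) - delta_mat m g $$ (p, q))"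
      using u E W by (simp add: unitary_op_expansion_iff)
    \<comment> \<open>Unitarity for \<open>E\<close> is a family of relations among the
      \<open>E f\<close>, and these pass to each constituent.\<close>
    then have "\<forall>p<m. \<forall>q<m. annihilates (d l) (D l) (\<lambda>g. correlation m W g $$ (p, q) - delta_mat m g $$ (p, q))"
      using annihilates_if_intertwines[OF E T irrep_irreducible[OF l]] by blast
    then show ?thesis
      using W True by (simp add: unitary_op_expansion_iff irrep_rep[OF l] Q_def)
  next
    case False
    have "mat_adjoint (1\<^sub>m (d l * m)) = (1\<^sub>m (d l * m) :: complex mat)"
      by (rule eq_matI) (auto simp: mat_adjoint_def mat_of_rows_def)
    then show ?thesis using False by (simp add: Q_def unitary_mat_def)
  qed
  have op: "op_expansion G (d l) m (D l) W' = Q l" if "l < \<kappa>" for l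
    by (rule op_expansion_synthesis[OF _ W' _ that]) (use Q in \<open>auto simp: unitary_mat_def W'_def\<close>)
  \<comment> \<open>\<open>W\<close> and \<open>W'\<close> have the same block at every constituent,
    so their difference is a relation there and hence for \<open>E\<close>.\<close>
  have "annihilates n E (\<lambda>f. W f $$ (p, q) - W' f $$ (p, q))" if pq: "p < m" "q < m" for p q
    using E
  proof (rule annihilates_if_annihilates_constituents)
    fix l T assume l: "l < \<kappa>"
      and T: "intertwines G n E (d l) (D l) T" "T \<noteq> 0\<^sub>m n (d l)"
    then have "op_expansion G (d l) m (D l) W = op_expansion G (d l) m (D l) W'"
      using op[OF l] by (auto simp: Q_def occurs_def)
    then show "annihilates (d l) (D l) (\<lambda>f. W f $$ (p, q) - W' f $$ (p, q))"
      using W W' pq by (simp add: op_expansion_eq_iff irrep_carrier[OF l])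
  qed
  then have "op_expansion G n m E W = op_expansion G n m E W'"
    using W W' by (simp add: op_expansion_eq_iff rep_carrier[OF E])
  moreover have "unitary_coefficients G \<kappa> d D m W'"
    using W' by (simp add: unitary_coefficients_iff_op_expansion op Q)
  ultimately show ?thesis using W' by blast
qed

end

section \<open>Cocycle laws from the given representation, and the final assembly\<close>

text \<open>A multiple of a unitary matrix of positive size determines its scalar. The cocycle law
  is thus associativity of E(f) E(g) E(h), and the normalization comes from E(e) = I.\<close>

lemma factor_system_of_rep:
  fixes G (structure)
  assumes "group G" and "finite (carrier G)" and n: "0 < n" and E: "proj_unitary_rep G \<mu> n E"
    and one: "E \<one> = 1\<^sub>m n"
  shows "factor_system G \<mu>"
proof -
  interpret group G by fact
  have c: "E f \<in> carrier_mat n n" and u: "mat_adjoint (E f) * E f = 1\<^sub>m n" if "f \<in> carrier G" for f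
    using E that by (simp_all add: proj_unitary_rep_def unitary_mat_def)
  have m: "E f * E g = \<mu> f g \<cdot>\<^sub>m E (f \<otimes> g)" if "f \<in> carrier G" "g \<in> carrier G" for f g
    using E that by (simp add: proj_unitary_rep_def)
  have cancel: "x = y" if f: "f \<in> carrier G" and xy: "x \<cdot>\<^sub>m E f = y \<cdot>\<^sub>m E f" for f and x y :: complex
  proof -
    have "x \<cdot>\<^sub>m 1\<^sub>m n = mat_adjoint (E f) * (x \<cdot>\<^sub>m E f)" for x
      using mult_smult_distrib[OF mat_adjoint_carrier[OF c[OF f]] c[OF f]] u[OF f] by simp
    then have "x \<cdot>\<^sub>m 1\<^sub>m n = y \<cdot>\<^sub>m (1\<^sub>m n :: complex mat)" using xy by simp
    then have "(x \<cdot>\<^sub>m 1\<^sub>m n) $$ (0, 0) = (y \<cdot>\<^sub>m (1\<^sub>m n :: complex mat)) $$ (0, 0)" by simp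
    then show ?thesis using n by simp
  qed
  have one_smult: "1 \<cdot>\<^sub>m A = A" for A :: "complex mat" by (rule eq_matI) auto
  have smult_smult: "x \<cdot>\<^sub>m (y \<cdot>\<^sub>m A) = (x * y) \<cdot>\<^sub>m A" for x y and A :: "complex mat"
    by (rule eq_matI) auto
  show ?thesis
  proof
    show "finite (carrier G)" by fact
    fix f assume f: "f \<in> carrier G"
    have "\<mu> \<one> f \<cdot>\<^sub>m E f = 1 \<cdot>\<^sub>m E f" using m[OF one_closed f] c[OF f] f by (simp add: one one_smult)
    then show "\<mu> \<one> f = 1" by (rule cancel[OF f])
    have "\<mu> f \<one> \<cdot>\<^sub>m E f = 1 \<cdot>\<^sub>m E f" using m[OF f one_closed] c[OF f] f by (simp add: one one_smult)
    then show "\<mu> f \<one> = 1" by (rule cancel[OF f])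
    fix g assume g: "g \<in> carrier G"
    show "cmod (\<mu> f g) = 1" using E f g by (simp add: proj_unitary_rep_def)
    fix h assume h: "h \<in> carrier G"
    have "(\<mu> f g * \<mu> (f \<otimes> g) h) \<cdot>\<^sub>m E (f \<otimes> g \<otimes> h) = (E f * E g) * E h"
      using f g h c by (simp add: m mult_smult_assoc_mat[OF c[OF m_closed[OF f g]] c[OF h]] smult_smult)
    also have "\<dots> = E f * (E g * E h)" by (rule assoc_mult_mat[OF c[OF f] c[OF g] c[OF h]])
    also have "\<dots> = (\<mu> g h * \<mu> f (g \<otimes> h)) \<cdot>\<^sub>m E (f \<otimes> g \<otimes> h)"
      using f g h c by (simp add: m mult_smult_distrib[OF c[OF f] c[OF m_closed[OF g h]]] smult_smult m_assoc)
    finally show "\<mu> f g * \<mu> (f \<otimes> g) h = \<mu> g h * \<mu> f (g \<otimes> h)"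
      using f g h by (intro cancel[of "f \<otimes> g \<otimes> h"]) auto
  qed
qed

theorem theorem5:
  fixes G :: "('g, 'm) monoid_scheme"
    and \<mu> :: "'g \<Rightarrow> 'g \<Rightarrow> complex"
    and dA dB \<kappa> :: nat
    and d :: "nat \<Rightarrow> nat"
    and D :: "nat \<Rightarrow> 'g \<Rightarrow> complex mat"
    and b :: "nat \<Rightarrow> 'g"
    and U W :: "'g \<Rightarrow> complex mat"
  assumes "group G" and "finite (carrier G)"
    and "bij_betw b {..<Coset.order G} (carrier G)"
    and "0 < dA"
    and "proj_unitary_rep G \<mu> dA U" and "U \<one>\<^bsub>G\<^esub> = 1\<^sub>m dA"
    and "complete_irrep_list G \<mu> \<kappa> d D" and "(\<Sum>l<\<kappa>. (d l)\<^sup>2) = Coset.order G"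
    and "\<forall>f\<in>carrier G. W f \<in> carrier_mat dB dB"
  shows
    "((regular_unitary G \<mu> b dB W \<longleftrightarrow> unitary_coefficients G \<kappa> d D dB W) \<and>
      (unitary_coefficients G \<kappa> d D dB W \<longleftrightarrow> twisted_orthonormal G \<mu> dB W)) \<and>
     ((regular_unitary G \<mu> b dB W \<longrightarrow> unitary_mat (dA * dB) (op_expansion G dA dB U W)) \<and>
      (unitary_coefficients G \<kappa> d D dB W \<longrightarrow> unitary_mat (dA * dB) (op_expansion G dA dB U W)) \<and>
      (twisted_orthonormal G \<mu> dB W \<longrightarrow> unitary_mat (dA * dB) (op_expansion G dA dB U W))) \<and>
     (unitary_mat (dA * dB) (op_expansion G dA dB U W) \<and> lin_indep_ops G dA U \<longrightarrow>
        regular_unitary G \<mu> b dB W \<and> unitary_coefficients G \<kappa> d D dB W \<and>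
        twisted_orthonormal G \<mu> dB W) \<and>
     (unitary_mat (dA * dB) (op_expansion G dA dB U W) \<and> \<not> lin_indep_ops G dA U \<longrightarrow>
        (\<exists>W'. (\<forall>f\<in>carrier G. W' f \<in> carrier_mat dB dB) \<and>
           op_expansion G dA dB U W = op_expansion G dA dB U W' \<and>
           regular_unitary G \<mu> b dB W' \<and> unitary_coefficients G \<kappa> d D dB W' \<and>
           twisted_orthonormal G \<mu> dB W'))"
proof -
  interpret factor_system G \<mu>
    by (rule factor_system_of_rep[OF assms(1,2,4,5,6)])
  interpret irrep_list G \<mu> \<kappa> d D
    by unfold_locales (fact assms)+
  \<comment> \<open>Both equivalences are stated for an arbitrary family, since they are applied to
    \<open>W\<close> and, for (d), to the replacement \<open>W'\<close>.\<close>
  have reg: "regular_unitary G \<mu> b dB X \<longleftrightarrow> twisted_orthonormal G \<mu> dB X"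
    and coeff: "unitary_coefficients G \<kappa> d D dB X \<longleftrightarrow> twisted_orthonormal G \<mu> dB X"
    if "\<forall>f\<in>carrier G. X f \<in> carrier_mat dB dB" for X
    using that by (auto intro!: regular_unitary_iff[OF assms(3)] unitary_coefficients_iff)
  have b: "unitary_mat (dA * dB) (op_expansion G dA dB U W)" if "twisted_orthonormal G \<mu> dB W"
    using assms(5,9) that by (auto intro: unitary_op_expansion_if_twisted_orthonormal)
  have c: "twisted_orthonormal G \<mu> dB W"
    if "unitary_mat (dA * dB) (op_expansion G dA dB U W)" "lin_indep_ops G dA U"
    using assms(5,9) that by (auto intro: twisted_orthonormal_if_unitary_op_expansion)
  have d: "\<exists>W'. (\<forall>f\<in>carrier G. W' f \<in> carrier_mat dB dB) \<and>
      op_expansion G dA dB U W = op_expansion G dA dB U W' \<and> unitary_coefficients G \<kappa> d D dB W'"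
    if "unitary_mat (dA * dB) (op_expansion G dA dB U W)"
    using assms(5,9) that by (intro ex_equivalent_unitary_coefficients) auto
  show ?thesis
    using reg coeff b c d assms(9) by metis
qed

end
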